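(* The $\mu$-focused system is sound and complete with respect to $\mu$MALL: if $\vdash\ \Uparrow\Gamma$ is provable in the $\mu$-focused system, then $\vdash\Gamma$ is provable in $\mu$MALL; and if $\vdash\Gamma$ has a quasi-finite $\mu$MALL derivation, then $\vdash\ \Uparrow\Gamma$ has a focused derivation.
   Context: $\mu$MALL is first-order MALL (connectives $\otimes$, ⅋ (par), $\oplus$, $\&$, $\mathbf{1},\bot,\mathbf{0},\top$, $\forall,\exists$, $=$, $\neq$) with least/greatest fixed points $\mu B\vec t,\nu B\vec t$ of monotonic operators, an unfolding rule for $\mu$ and a (co)induction rule for $\nu$ with coinvariant $S$ (from $\vdash\Gamma,S\vec t$ and $\vdash BS\vec x,(S\vec x)^\perp$ infer $\vdash\Gamma,\nu B\vec t$). A derivation is quasi-finite if it is cut-free, has finite height, and uses only finitely many distinct coinvariants. The $\mu$-focused system classifies ⅋, $\bot$, $\&$, $\top$, $\forall$, $\neq$, $\nu$ and negated atoms as asynchronous, and their duals ($\otimes,\mathbf{1},\oplus,\mathbf{0},\exists,=,\mu$, atoms) as synchronous. Sequents are $\vdash\Gamma\Uparrow\Delta$ (asynchronous phase) and $\vdash\Gamma\Downarrow P$ (focus on $P$), where $\Gamma$ contains only synchronous formulas or frozen formulas $P^*$ ($P$ a negated atom or greatest fixed point). In the asynchronous phase, asynchronous connectives are introduced in any order; a negated atom is frozen; a $\nu B\vec t$ is either coinducted on (with coinvariance premise $\vdash\ \Uparrow BS\vec x,(S\vec x)^\perp$) or frozen. In the synchronous phase, the focused formula's synchronous connectives are introduced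 hereditarily, $\mu B\vec t$ is either unfolded or closed by the axiom $\vdash(\nu\overline{B}\vec t)^*\Downarrow\mu B\vec t$, and an atom $a\vec t$ is closed by $\vdash(a^\perp\vec t)^*\Downarrow a\vec t$. Switching rules move synchronous formulas from $\Delta$ to $\Gamma$, start a focus on some $P$ from $\vdash\Gamma,P\Uparrow\ $ (empty $\Delta$), and release focus on an asynchronous formula. *)

theory Defs
  imports "HOL-Library.Multiset" "HOL-Library.Extended_Nat"
begin

text \<open>
  Binding is represented by de Bruijn indices, with separate index spaces for term variables and
  predicate variables. Free term variables of a sequent play the role of eigenvariables.
\<close>

datatype 'f trm = Var nat | Fn 'f "'f trm list"

type_synonym 'f subst = "nat \<Rightarrow> 'f trm"

primrec tsubst :: "'f subst \<Rightarrow> 'f trm \<Rightarrow> 'f trm" where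
  "tsubst \<sigma> (Var i) = \<sigma> i"
| "tsubst \<sigma> (Fn f ts) = Fn f (map (tsubst \<sigma>) ts)"

text \<open>
  The constructors \<open>Mu B ts\<close> and \<open>Nu B ts\<close> stand for fixed points applied to \<open>ts\<close>. In the body \<open>B\<close>
  they bind predicate variable \<open>0\<close> and the \<open>length ts\<close> term variables \<open>0, \<dots>, length ts - 1\<close>, the
  \<open>i\<close>-th parameter being \<open>Var i\<close>. There is no negated predicate variable, so every operator
  that can be written is monotonic.
\<close>

datatype ('f, 'a) form =
    Atom 'a "'f trm list"
  | NAtom 'a "'f trm list"
  | PVar nat "'f trm list"
  | Eq "'f trm" "'f trm"
  | Neq "'f trm" "'f trm"
  | One | Bot | Zero | Top
  | Tensor "('f, 'a) form" "('f, 'a) form"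
  | Par "('f, 'a) form" "('f, 'a) form"
  | Plus "('f, 'a) form" "('f, 'a) form"
  | With "('f, 'a) form" "('f, 'a) form"
  | Exists "('f, 'a) form"
  | Forall "('f, 'a) form"
  | Mu "('f, 'a) form" "'f trm list"
  | Nu "('f, 'a) form" "'f trm list"

record ('f, 'a) signature =
  funs :: "('f \<times> nat) set"
  preds :: "('a \<times> nat) set"

primrec wft :: "('f, 'a) signature \<Rightarrow> 'f trm \<Rightarrow> bool" where
  "wft L (Var i) \<longleftrightarrow> True"
| "wft L (Fn f ts) \<longleftrightarrow> (f, length ts) \<in> funs L \<and> list_all (wft L) ts"

definition wfs :: "('f, 'a) signature \<Rightarrow> 'f subst \<Rightarrow> bool" where
  "wfs L \<sigma> \<longleftrightarrow> (\<forall>i. wft L (\<sigma> i))"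

text \<open>
  The list \<open>as\<close> gives the arities of the predicate variables in scope. The formulas of the logic
  proper are those that are well-formed for \<open>[]\<close>, i.e. that have no free predicate variable.
\<close>

primrec wff :: "('f, 'a) signature \<Rightarrow> nat list \<Rightarrow> ('f, 'a) form \<Rightarrow> bool" where
  "wff L as (Atom a ts) \<longleftrightarrow> (a, length ts) \<in> preds L \<and> list_all (wft L) ts"
| "wff L as (NAtom a ts) \<longleftrightarrow> (a, length ts) \<in> preds L \<and> list_all (wft L) ts"
| "wff L as (PVar p ts) \<longleftrightarrow> p < length as \<and> length ts = as ! p \<and> list_all (wft L) ts"
| "wff L as (Eq s t) \<longleftrightarrow> wft L s \<and> wft L t"
| "wff L as (Neq s t) \<longleftrightarrow> wft L s \<and> wft L t"
| "wff L as One \<longleftrightarrow> True"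
| "wff L as Bot \<longleftrightarrow> True"
| "wff L as Zero \<longleftrightarrow> True"
| "wff L as Top \<longleftrightarrow> True"
| "wff L as (Tensor P Q) \<longleftrightarrow> wff L as P \<and> wff L as Q"
| "wff L as (Par P Q) \<longleftrightarrow> wff L as P \<and> wff L as Q"
| "wff L as (Plus P Q) \<longleftrightarrow> wff L as P \<and> wff L as Q"
| "wff L as (With P Q) \<longleftrightarrow> wff L as P \<and> wff L as Q"
| "wff L as (Exists P) \<longleftrightarrow> wff L as P"
| "wff L as (Forall P) \<longleftrightarrow> wff L as P"
| "wff L as (Mu B ts) \<longleftrightarrow> wff L (length ts # as) B \<and> list_all (wft L) ts"
| "wff L as (Nu B ts) \<longleftrightarrow> wff L (length ts # as) B \<and> list_all (wft L) ts"

text \<open>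
  Predicate variables are left unchanged, so that on the body of an operator \<open>B\<close> this computes the
  dual operator \<open>\<lambda>p x. (B (\<lambda>x. (p x)\<^sup>\<bottom>) x)\<^sup>\<bottom>\<close>.
\<close>

primrec neg :: "('f, 'a) form \<Rightarrow> ('f, 'a) form" where
  "neg (Atom a ts) = NAtom a ts"
| "neg (NAtom a ts) = Atom a ts"
| "neg (PVar p ts) = PVar p ts"
| "neg (Eq s t) = Neq s t"
| "neg (Neq s t) = Eq s t"
| "neg One = Bot"
| "neg Bot = One"
| "neg Zero = Top"
| "neg Top = Zero"
| "neg (Tensor P Q) = Par (neg P) (neg Q)"
| "neg (Par P Q) = Tensor (neg P) (neg Q)"
| "neg (Plus P Q) = With (neg P) (neg Q)"
| "neg (With P Q) = Plus (neg P) (neg Q)"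
| "neg (Exists P) = Forall (neg P)"
| "neg (Forall P) = Exists (neg P)"
| "neg (Mu B ts) = Nu (neg B) ts"
| "neg (Nu B ts) = Mu (neg B) ts"

definition lift :: "nat \<Rightarrow> 'f subst \<Rightarrow> 'f subst" where
  "lift n \<sigma> i = (if i < n then Var i else tsubst (\<lambda>j. Var (j + n)) (\<sigma> (i - n)))"

primrec fsubst :: "'f subst \<Rightarrow> ('f, 'a) form \<Rightarrow> ('f, 'a) form" where
  "fsubst \<sigma> (Atom a ts) = Atom a (map (tsubst \<sigma>) ts)"
| "fsubst \<sigma> (NAtom a ts) = NAtom a (map (tsubst \<sigma>) ts)"
| "fsubst \<sigma> (PVar p ts) = PVar p (map (tsubst \<sigma>) ts)"
| "fsubst \<sigma> (Eq s t) = Eq (tsubst \<sigma> s) (tsubst \<sigma> t)"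
| "fsubst \<sigma> (Neq s t) = Neq (tsubst \<sigma> s) (tsubst \<sigma> t)"
| "fsubst \<sigma> One = One"
| "fsubst \<sigma> Bot = Bot"
| "fsubst \<sigma> Zero = Zero"
| "fsubst \<sigma> Top = Top"
| "fsubst \<sigma> (Tensor P Q) = Tensor (fsubst \<sigma> P) (fsubst \<sigma> Q)"
| "fsubst \<sigma> (Par P Q) = Par (fsubst \<sigma> P) (fsubst \<sigma> Q)"
| "fsubst \<sigma> (Plus P Q) = Plus (fsubst \<sigma> P) (fsubst \<sigma> Q)"
| "fsubst \<sigma> (With P Q) = With (fsubst \<sigma> P) (fsubst \<sigma> Q)"
| "fsubst \<sigma> (Exists P) = Exists (fsubst (lift 1 \<sigma>) P)"
| "fsubst \<sigma> (Forall P) = Forall (fsubst (lift 1 \<sigma>) P)"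
| "fsubst \<sigma> (Mu B ts) = Mu (fsubst (lift (length ts) \<sigma>) B) (map (tsubst \<sigma>) ts)"
| "fsubst \<sigma> (Nu B ts) = Nu (fsubst (lift (length ts) \<sigma>) B) (map (tsubst \<sigma>) ts)"

text \<open>
  An \<open>n\<close>-ary predicate \<open>\<lambda>x. S\<close> is represented by its body \<open>S\<close>, with parameters \<open>0, \<dots>, n - 1\<close>.
  \<open>inst ts S\<close> is the predicate applied to \<open>ts\<close>; \<open>shift n d S\<close> is the same predicate moved under \<open>d\<close>
  further term binders.
\<close>

definition inst :: "'f trm list \<Rightarrow> ('f, 'a) form \<Rightarrow> ('f, 'a) form" where
  "inst ts = fsubst (\<lambda>i. if i < length ts then ts ! i else Var (i - length ts))"

definition shift :: "nat \<Rightarrow> nat \<Rightarrow> ('f, 'a) form \<Rightarrow> ('f, 'a) form" where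
  "shift n d = fsubst (lift n (\<lambda>i. Var (i + d)))"

text \<open>
  \<open>psubst n S k P\<close> replaces predicate variable \<open>k\<close> of \<open>P\<close> by the \<open>n\<close>-ary predicate \<open>S\<close>. It is
  only used for \<open>S\<close> without free predicate variables, hence \<open>S\<close> is never shifted for these.
\<close>

primrec psubst :: "nat \<Rightarrow> ('f, 'a) form \<Rightarrow> nat \<Rightarrow> ('f, 'a) form \<Rightarrow> ('f, 'a) form" where
  "psubst n S k (Atom a ts) = Atom a ts"
| "psubst n S k (NAtom a ts) = NAtom a ts"
| "psubst n S k (PVar p ts) =
     (if p = k then inst ts S else PVar (if p < k then p else p - 1) ts)"
| "psubst n S k (Eq s t) = Eq s t"
| "psubst n S k (Neq s t) = Neq s t"
| "psubst n S k One = One"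
| "psubst n S k Bot = Bot"
| "psubst n S k Zero = Zero"
| "psubst n S k Top = Top"
| "psubst n S k (Tensor P Q) = Tensor (psubst n S k P) (psubst n S k Q)"
| "psubst n S k (Par P Q) = Par (psubst n S k P) (psubst n S k Q)"
| "psubst n S k (Plus P Q) = Plus (psubst n S k P) (psubst n S k Q)"
| "psubst n S k (With P Q) = With (psubst n S k P) (psubst n S k Q)"
| "psubst n S k (Exists P) = Exists (psubst n (shift n 1 S) k P)"
| "psubst n S k (Forall P) = Forall (psubst n (shift n 1 S) k P)"
| "psubst n S k (Mu B ts) = Mu (psubst n (shift n (length ts) S) (Suc k) B) ts"
| "psubst n S k (Nu B ts) = Nu (psubst n (shift n (length ts) S) (Suc k) B) ts"

text \<open>
  \<open>app_op n B S\<close> is \<open>B S x\<close> for the \<open>n\<close> variables \<open>x\<close> = \<open>Var 0, \<dots>, Var (n - 1)\<close>, with all free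
  variables of \<open>B\<close> and \<open>S\<close> moved above them. In the same extended context \<open>S x\<close> is \<open>S\<close> itself.
\<close>

definition app_op :: "nat \<Rightarrow> ('f, 'a) form \<Rightarrow> ('f, 'a) form \<Rightarrow> ('f, 'a) form" where
  "app_op n B S = psubst n (shift n n S) 0 B"

definition unfold_mu :: "('f, 'a) form \<Rightarrow> 'f trm list \<Rightarrow> ('f, 'a) form" where
  "unfold_mu B ts =
     (let n = length ts in inst ts (app_op n B (Mu (shift n n B) (map Var [0..<n]))))"

definition complete_unifiers ::
  "('f, 'a) signature \<Rightarrow> 'f trm \<Rightarrow> 'f trm \<Rightarrow> 'f subst set \<Rightarrow> bool" where
  "complete_unifiers L u v U \<longleftrightarrow>
     (\<forall>\<theta>\<in>U. wfs L \<theta> \<and> tsubst \<theta> u = tsubst \<theta> v) \<and>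
     (\<forall>\<sigma>. wfs L \<sigma> \<and> tsubst \<sigma> u = tsubst \<sigma> v \<longrightarrow>
        (\<exists>\<theta>\<in>U. \<exists>\<tau>. wfs L \<tau> \<and> (\<forall>i. \<sigma> i = tsubst \<tau> (\<theta> i))))"

text \<open>
  Derivations are recorded as trees of rule applications, keeping what matters for quasi-finiteness:
  \<open>CutD\<close> marks cuts, \<open>NuD n S d e\<close> a (co)induction with the \<open>n\<close>-ary coinvariant \<open>S\<close>, and \<open>NeqD U D\<close>
  a disequality rule, which has one premise for each \<open>\<theta> \<in> U\<close> and may be infinitely branching;
  \<open>Node0\<close>, \<open>Node1\<close>, \<open>Node2\<close> are the other rules, by number of premises.
\<close>

datatype ('f, 'a) deriv =
    Node0
  | Node1 "('f, 'a) deriv"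
  | Node2 "('f, 'a) deriv" "('f, 'a) deriv"
  | CutD "('f, 'a) deriv" "('f, 'a) deriv"
  | NuD nat "('f, 'a) form" "('f, 'a) deriv" "('f, 'a) deriv"
  | NeqD "'f subst set" "'f subst \<Rightarrow> ('f, 'a) deriv"

inductive derives ::
  "('f, 'a) signature \<Rightarrow> ('f, 'a) deriv \<Rightarrow> ('f, 'a) form multiset \<Rightarrow> bool"
  for L where
  init: "derives L Node0 {#P, neg P#}"
| cut: "\<lbrakk>wff L [] P; derives L d (add_mset P \<Gamma>); derives L e (add_mset (neg P) \<Delta>)\<rbrakk>
    \<Longrightarrow> derives L (CutD d e) (\<Gamma> + \<Delta>)"
| one: "derives L Node0 {#One#}"
| bot: "derives L d \<Gamma> \<Longrightarrow> derives L (Node1 d) (add_mset Bot \<Gamma>)"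
| top: "derives L Node0 (add_mset Top \<Gamma>)"
| tensor: "\<lbrakk>derives L d (add_mset P \<Gamma>); derives L e (add_mset Q \<Delta>)\<rbrakk>
    \<Longrightarrow> derives L (Node2 d e) (add_mset (Tensor P Q) (\<Gamma> + \<Delta>))"
| par: "derives L d (add_mset P (add_mset Q \<Gamma>))
    \<Longrightarrow> derives L (Node1 d) (add_mset (Par P Q) \<Gamma>)"
| plus1: "derives L d (add_mset P \<Gamma>) \<Longrightarrow> derives L (Node1 d) (add_mset (Plus P Q) \<Gamma>)"
| plus2: "derives L d (add_mset Q \<Gamma>) \<Longrightarrow> derives L (Node1 d) (add_mset (Plus P Q) \<Gamma>)"
| with_: "\<lbrakk>derives L d (add_mset P \<Gamma>); derives L e (add_mset Q \<Gamma>)\<rbrakk>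
    \<Longrightarrow> derives L (Node2 d e) (add_mset (With P Q) \<Gamma>)"
| ex: "\<lbrakk>wft L t; derives L d (add_mset (inst [t] P) \<Gamma>)\<rbrakk>
    \<Longrightarrow> derives L (Node1 d) (add_mset (Exists P) \<Gamma>)"
| all: "derives L d (add_mset P (image_mset (fsubst (\<lambda>i. Var (Suc i))) \<Gamma>))
    \<Longrightarrow> derives L (Node1 d) (add_mset (Forall P) \<Gamma>)"
| eq: "derives L Node0 {#Eq t t#}"
| neq: "\<lbrakk>complete_unifiers L u v U; \<And>\<theta>. \<theta> \<in> U \<Longrightarrow> derives L (D \<theta>) (image_mset (fsubst \<theta>) \<Gamma>)\<rbrakk>
    \<Longrightarrow> derives L (NeqD U D) (add_mset (Neq u v) \<Gamma>)"
| mu: "derives L d (add_mset (unfold_mu B ts) \<Gamma>)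
    \<Longrightarrow> derives L (Node1 d) (add_mset (Mu B ts) \<Gamma>)"
| nu: "\<lbrakk>n = length ts; wff L [] S;
     derives L d (add_mset (inst ts S) \<Gamma>); derives L e {#app_op n B S, neg S#}\<rbrakk>
    \<Longrightarrow> derives L (NuD n S d e) (add_mset (Nu B ts) \<Gamma>)"

definition muMALL_provable :: "('f, 'a) signature \<Rightarrow> ('f, 'a) form multiset \<Rightarrow> bool" where
  "muMALL_provable L \<Gamma> \<longleftrightarrow> (\<exists>d. derives L d \<Gamma>)"

primrec cut_free :: "('f, 'a) deriv \<Rightarrow> bool" where
  "cut_free Node0 \<longleftrightarrow> True"
| "cut_free (Node1 d) \<longleftrightarrow> cut_free d"
| "cut_free (Node2 d e) \<longleftrightarrow> cut_free d \<and> cut_free e"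
| "cut_free (CutD d e) \<longleftrightarrow> False"
| "cut_free (NuD n S d e) \<longleftrightarrow> cut_free d \<and> cut_free e"
| "cut_free (NeqD U D) \<longleftrightarrow> (\<forall>\<theta>\<in>U. cut_free (D \<theta>))"

primrec height :: "('f, 'a) deriv \<Rightarrow> enat" where
  "height Node0 = 1"
| "height (Node1 d) = eSuc (height d)"
| "height (Node2 d e) = eSuc (max (height d) (height e))"
| "height (CutD d e) = eSuc (max (height d) (height e))"
| "height (NuD n S d e) = eSuc (max (height d) (height e))"
| "height (NeqD U D) = eSuc (SUP \<theta>\<in>U. height (D \<theta>))"

primrec coinvariants :: "('f, 'a) deriv \<Rightarrow> (nat \<times> ('f, 'a) form) set" where
  "coinvariants Node0 = {}"
| "coinvariants (Node1 d) = coinvariants d"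
| "coinvariants (Node2 d e) = coinvariants d \<union> coinvariants e"
| "coinvariants (CutD d e) = coinvariants d \<union> coinvariants e"
| "coinvariants (NuD n S d e) = insert (n, S) (coinvariants d \<union> coinvariants e)"
| "coinvariants (NeqD U D) = (\<Union>\<theta>\<in>U. coinvariants (D \<theta>))"

definition quasi_finite :: "('f, 'a) deriv \<Rightarrow> bool" where
  "quasi_finite d \<longleftrightarrow> cut_free d \<and> height d < \<infinity> \<and> finite (coinvariants d)"

fun asynchronous :: "('f, 'a) form \<Rightarrow> bool" where
  "asynchronous (Par P Q) = True"
| "asynchronous Bot = True"
| "asynchronous (With P Q) = True"
| "asynchronous Top = True"
| "asynchronous (Forall P) = True"
| "asynchronous (Neq s t) = True"
| "asynchronous (Nu B ts) = True"
| "asynchronous (NAtom a ts) = True"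
| "asynchronous _ = False"

fun synchronous :: "('f, 'a) form \<Rightarrow> bool" where
  "synchronous (Tensor P Q) = True"
| "synchronous One = True"
| "synchronous (Plus P Q) = True"
| "synchronous Zero = True"
| "synchronous (Exists P) = True"
| "synchronous (Eq s t) = True"
| "synchronous (Mu B ts) = True"
| "synchronous (Atom a ts) = True"
| "synchronous _ = False"

datatype ('f, 'a) item = Plain "('f, 'a) form" | Frozen "('f, 'a) form"

primrec isubst :: "'f subst \<Rightarrow> ('f, 'a) item \<Rightarrow> ('f, 'a) item" where
  "isubst \<sigma> (Plain P) = Plain (fsubst \<sigma> P)"
| "isubst \<sigma> (Frozen P) = Frozen (fsubst \<sigma> P)"

text \<open>
  \<open>foc_up L \<Gamma> \<Delta>\<close> is provability of \<open>\<turnstile> \<Gamma> \<Up> \<Delta>\<close> and \<open>foc_down L \<Gamma> P\<close> that of \<open>\<turnstile> \<Gamma> \<Down> P\<close>. The rules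
  only ever put synchronous plain formulas, and negated atoms or greatest fixed points as
  frozen formulas, into \<open>\<Gamma>\<close>.
\<close>

inductive
  foc_up :: "('f, 'a) signature \<Rightarrow> ('f, 'a) item multiset \<Rightarrow> ('f, 'a) form multiset \<Rightarrow> bool"
  and foc_down :: "('f, 'a) signature \<Rightarrow> ('f, 'a) item multiset \<Rightarrow> ('f, 'a) form \<Rightarrow> bool"
  for L where
  f_par: "foc_up L \<Gamma> (add_mset P (add_mset Q \<Delta>)) \<Longrightarrow> foc_up L \<Gamma> (add_mset (Par P Q) \<Delta>)"
| f_with: "\<lbrakk>foc_up L \<Gamma> (add_mset P \<Delta>); foc_up L \<Gamma> (add_mset Q \<Delta>)\<rbrakk>
    \<Longrightarrow> foc_up L \<Gamma> (add_mset (With P Q) \<Delta>)"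
| f_bot: "foc_up L \<Gamma> \<Delta> \<Longrightarrow> foc_up L \<Gamma> (add_mset Bot \<Delta>)"
| f_top: "foc_up L \<Gamma> (add_mset Top \<Delta>)"
| f_all: "foc_up L (image_mset (isubst (\<lambda>i. Var (Suc i))) \<Gamma>)
                   (add_mset P (image_mset (fsubst (\<lambda>i. Var (Suc i))) \<Delta>))
    \<Longrightarrow> foc_up L \<Gamma> (add_mset (Forall P) \<Delta>)"
| f_neq: "\<lbrakk>complete_unifiers L u v U;
     \<And>\<theta>. \<theta> \<in> U \<Longrightarrow> foc_up L (image_mset (isubst \<theta>) \<Gamma>) (image_mset (fsubst \<theta>) \<Delta>)\<rbrakk>
    \<Longrightarrow> foc_up L \<Gamma> (add_mset (Neq u v) \<Delta>)"
| f_nu: "\<lbrakk>wff L [] S; foc_up L \<Gamma> (add_mset (inst ts S) \<Delta>);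
     foc_up L {#} {#app_op (length ts) B S, neg S#}\<rbrakk>
    \<Longrightarrow> foc_up L \<Gamma> (add_mset (Nu B ts) \<Delta>)"
| f_freeze_nu: "foc_up L (add_mset (Frozen (Nu B ts)) \<Gamma>) \<Delta>
    \<Longrightarrow> foc_up L \<Gamma> (add_mset (Nu B ts) \<Delta>)"
| f_freeze_natom: "foc_up L (add_mset (Frozen (NAtom a ts)) \<Gamma>) \<Delta>
    \<Longrightarrow> foc_up L \<Gamma> (add_mset (NAtom a ts) \<Delta>)"
| f_store: "\<lbrakk>synchronous P; foc_up L (add_mset (Plain P) \<Gamma>) \<Delta>\<rbrakk>
    \<Longrightarrow> foc_up L \<Gamma> (add_mset P \<Delta>)"
| f_decide: "\<lbrakk>synchronous P; foc_down L \<Gamma> P\<rbrakk> \<Longrightarrow> foc_up L (add_mset (Plain P) \<Gamma>) {#}"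
| f_release: "\<lbrakk>asynchronous P; foc_up L \<Gamma> {#P#}\<rbrakk> \<Longrightarrow> foc_down L \<Gamma> P"
| f_tensor: "\<lbrakk>foc_down L \<Gamma> P; foc_down L \<Gamma>' Q\<rbrakk> \<Longrightarrow> foc_down L (\<Gamma> + \<Gamma>') (Tensor P Q)"
| f_plus1: "foc_down L \<Gamma> P \<Longrightarrow> foc_down L \<Gamma> (Plus P Q)"
| f_plus2: "foc_down L \<Gamma> Q \<Longrightarrow> foc_down L \<Gamma> (Plus P Q)"
| f_one: "foc_down L {#} One"
| f_ex: "\<lbrakk>wft L t; foc_down L \<Gamma> (inst [t] P)\<rbrakk> \<Longrightarrow> foc_down L \<Gamma> (Exists P)"
| f_eq: "foc_down L {#} (Eq t t)"
| f_mu: "foc_down L \<Gamma> (unfold_mu B ts) \<Longrightarrow> foc_down L \<Gamma> (Mu B ts)"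
| f_mu_init: "foc_down L {#Frozen (Nu (neg B) ts)#} (Mu B ts)"
| f_atom_init: "foc_down L {#Frozen (NAtom a ts)#} (Atom a ts)"

end

theory Submission
  imports Defs "HOL-Library.Set_Algebras"
begin

text \<open>
  The difficulty of completeness is that different branches of a derivation may treat the same
  greatest fixed point by different coinvariants, while in the focused system it has to be
  treated before these branches separate. This is solved by delaying: \<open>\<nu>B x \<oplus> 0\<close> is a
  coinvariant of \<open>\<nu>B\<close>, so in the asynchronous phase one may always trade \<open>\<nu>B t\<close> for the
  synchronous formula \<open>\<nu>B t \<oplus> 0\<close>, and focus on it later, when the coinvariant is known. With all
  fixed points delayed, the asynchronous phase is structural, and a sequent is called good if all
  the sequents to which this phase leads, under all substitutions, are focused provable. Good
  sequents are closed under all rules but the cut: for asynchronous rules this is immediate, and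
  for synchronous rules one follows the derivation of a premise up to the points where its
  principal formula gets the focus.
\<close>

section \<open>Substitution\<close>

lemma tsubst_tsubst: "tsubst \<sigma> (tsubst \<tau> t) = tsubst (\<lambda>i. tsubst \<sigma> (\<tau> i)) t"
  by (induction t) auto

lemma tsubst_Var [simp]: "tsubst Var t = t"
  by (induction t) (auto simp: map_idI)

lemma tsubst_Var_fun [simp]: "tsubst Var = id"
  by (rule ext) simp

lemma lift_Var [simp]: "lift n Var = Var"
  by (rule ext) (auto simp: lift_def)

lemma tsubst_lift_lift: "tsubst (lift n \<sigma>) (lift n \<tau> i) = lift n (\<lambda>i. tsubst \<sigma> (\<tau> i)) i"
  by (auto simp: lift_def tsubst_tsubst)

lemma fsubst_fsubst: "fsubst \<sigma> (fsubst \<tau> P) = fsubst (\<lambda>i. tsubst \<sigma> (\<tau> i)) P"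
  by (induction P arbitrary: \<sigma> \<tau>) (auto simp: tsubst_tsubst tsubst_lift_lift)

lemma fsubst_Var [simp]: "fsubst Var P = P"
  by (induction P) (auto simp: map_idI)

lemma fsubst_Var_fun [simp]: "fsubst Var = id"
  by (rule ext) simp

lemma isubst_isubst: "isubst \<sigma> (isubst \<tau> I) = isubst (\<lambda>i. tsubst \<sigma> (\<tau> i)) I"
  by (cases I) (auto simp: fsubst_fsubst)

lemma isubst_Var: "isubst Var I = I"
  by (cases I) auto

lemma isubst_Var_fun [simp]: "isubst Var = id"
  by (rule ext) (simp add: isubst_Var)

lemma image_mset_fsubst_fsubst:
  "image_mset (fsubst \<sigma>) (image_mset (fsubst \<tau>) \<Gamma>) = image_mset (fsubst (\<lambda>i. tsubst \<sigma> (\<tau> i))) \<Gamma>"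
  by (simp add: image_mset.compositionality comp_def fsubst_fsubst)

lemma image_mset_isubst_isubst:
  "image_mset (isubst \<sigma>) (image_mset (isubst \<tau>) \<Gamma>) = image_mset (isubst (\<lambda>i. tsubst \<sigma> (\<tau> i))) \<Gamma>"
  by (simp add: image_mset.compositionality comp_def isubst_isubst)

lemma neg_neg [simp]: "neg (neg P) = P"
  by (induction P) auto

lemma neg_fsubst [simp]: "neg (fsubst \<sigma> P) = fsubst \<sigma> (neg P)"
  by (induction P arbitrary: \<sigma>) auto

lemma neg_inst [simp]: "neg (inst ts P) = inst ts (neg P)"
  by (simp add: inst_def)

lemma neg_shift [simp]: "neg (shift n d P) = shift n d (neg P)"
  by (simp add: shift_def)

lemma neg_psubst [simp]: "neg (psubst n S k P) = psubst n (neg S) k (neg P)"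
  by (induction P arbitrary: k S) auto

lemma fsubst_inst:
  "fsubst \<sigma> (inst ts S) = inst (map (tsubst \<sigma>) ts) (fsubst (lift (length ts) \<sigma>) S)"
  unfolding inst_def fsubst_fsubst
  by (rule arg_cong[where f = "\<lambda>s. fsubst s S"]) (auto simp: lift_def tsubst_tsubst fun_eq_iff)

lemma inst_lift: "inst [t] (fsubst (lift (Suc 0) \<sigma>) P) = fsubst (case_nat t \<sigma>) P"
  unfolding inst_def fsubst_fsubst
  by (rule arg_cong[where f = "\<lambda>s. fsubst s P"])
     (auto simp: lift_def tsubst_tsubst fun_eq_iff split: nat.split)

lemma fsubst_shift:
  "fsubst (lift n (lift d \<sigma>)) (shift n d S) = shift n d (fsubst (lift n \<sigma>) S)"
  unfolding shift_def fsubst_fsubst tsubst_lift_lift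
  by (rule arg_cong[where f = "\<lambda>s. fsubst (lift n s) S"]) (auto simp: lift_def)

lemma fsubst_psubst:
  assumes "wff L as P" "k < length as" "as ! k = n"
  shows "fsubst \<sigma> (psubst n S k P) = psubst n (fsubst (lift n \<sigma>) S) k (fsubst \<sigma> P)"
  using assms
proof (induction P arbitrary: as k S \<sigma>)
  case (PVar p ts)
  then show ?case by (auto simp: fsubst_inst)
next
  case (Mu B ts)
  then show ?case using Mu.IH[of "length ts # as" "Suc k"] by (auto simp: fsubst_shift)
next
  case (Nu B ts)
  then show ?case using Nu.IH[of "length ts # as" "Suc k"] by (auto simp: fsubst_shift)
qed (auto simp: fsubst_shift)

lemma fsubst_app_op:
  assumes "wff L [n] B"
  shows "fsubst (lift n \<sigma>) (app_op n B S)
    = app_op n (fsubst (lift n \<sigma>) B) (fsubst (lift n \<sigma>) S)"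
  unfolding app_op_def by (subst fsubst_psubst[OF assms]) (auto simp: fsubst_shift)

lemma map_lift_Var [simp]: "map (tsubst (lift n \<sigma>)) (map Var [0..<n]) = map Var [0..<n]"
  by (auto simp: lift_def)

lemma inst_vars_shift: "inst (map Var [0..<n]) (shift n n P) = P"
proof -
  have "inst (map Var [0..<n]) (shift n n P) = fsubst Var P"
    unfolding inst_def shift_def fsubst_fsubst
    by (rule arg_cong[where f = "\<lambda>s. fsubst s P"]) (auto simp: lift_def)
  then show ?thesis by simp
qed

lemma inst_shift:
  "length ts = n \<Longrightarrow>
   fsubst (lift n (\<lambda>i. if i < n then ts ! i else Var (i - n))) (shift n n P) = P"
proof -
  assume n: "length ts = n"
  have "fsubst (lift n (\<lambda>i. if i < n then ts ! i else Var (i - n))) (shift n n P) = fsubst Var P"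
    unfolding shift_def fsubst_fsubst
    by (rule arg_cong[where f = "\<lambda>s. fsubst s P"]) (auto simp: lift_def)
  then show ?thesis by simp
qed

lemma map_inst_vars:
  "length ts = n \<Longrightarrow>
   map (tsubst (\<lambda>i. if i < n then ts ! i else Var (i - n))) (map Var [0..<n]) = ts"
  by (auto intro: nth_equalityI)

lemma inst_Nu_vars: "length ts = n \<Longrightarrow> inst ts (Nu (shift n n B) (map Var [0..<n])) = Nu B ts"
  using inst_shift[of ts n B] map_inst_vars[of ts n] by (auto simp: inst_def)

lemma inst_Plus: "inst ts (Plus P Q) = Plus (inst ts P) (inst ts Q)"
  and inst_Zero: "inst ts Zero = Zero"
  by (simp_all add: inst_def)

lemma fsubst_unfold_mu:
  assumes "wff L [length ts] B"
  shows "fsubst \<sigma> (unfold_mu B ts)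
    = unfold_mu (fsubst (lift (length ts) \<sigma>) B) (map (tsubst \<sigma>) ts)"
  using fsubst_app_op[OF assms] map_lift_Var[of "length ts" \<sigma>]
  by (simp add: unfold_mu_def Let_def fsubst_inst fsubst_shift del: map_map)

lemma unfold_mu_vars:
  assumes "wff L [n] B"
  shows "unfold_mu (shift n n B) (map Var [0..<n]) = app_op n B (Mu (shift n n B) (map Var [0..<n]))"
proof -
  let ?\<sigma> = "\<lambda>i. Var (i + n)"
  have "app_op n (shift n n B) (Mu (shift n n (shift n n B)) (map Var [0..<n]))
    = shift n n (app_op n B (Mu (shift n n B) (map Var [0..<n])))"
    using fsubst_app_op[OF assms, of ?\<sigma>] map_lift_Var[of n ?\<sigma>] fsubst_shift[of n n ?\<sigma> B]
    by (simp add: shift_def del: map_map)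
  then show ?thesis by (simp add: unfold_mu_def inst_vars_shift)
qed

lemma wft_tsubst: "wft L t \<Longrightarrow> wfs L \<sigma> \<Longrightarrow> wft L (tsubst \<sigma> t)"
  by (induction t) (auto simp: wfs_def list_all_iff)

lemma list_all_wft_tsubst: "list_all (wft L) ts \<Longrightarrow> wfs L \<sigma> \<Longrightarrow> list_all (wft L \<circ> tsubst \<sigma>) ts"
  by (auto simp: list_all_iff wft_tsubst)

lemma wfs_Var [simp]: "wfs L Var"
  by (simp add: wfs_def)

lemma wfs_renaming [simp]: "wfs L (\<lambda>i. Var (f i))"
  by (simp add: wfs_def)

lemma wfs_lift [simp]: "wfs L \<sigma> \<Longrightarrow> wfs L (lift n \<sigma>)"
  by (auto simp: wfs_def lift_def intro: wft_tsubst[unfolded wfs_def])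

lemma wfs_comp: "wfs L \<sigma> \<Longrightarrow> wfs L \<tau> \<Longrightarrow> wfs L (\<lambda>i. tsubst \<sigma> (\<tau> i))"
  using wft_tsubst[of L _ \<sigma>] by (auto simp: wfs_def)

lemma wfs_case_nat: "wft L t \<Longrightarrow> wfs L \<sigma> \<Longrightarrow> wfs L (case_nat t \<sigma>)"
  by (auto simp: wfs_def split: nat.split)

lemma wfs_nth: "list_all (wft L) ts \<Longrightarrow> wfs L (\<lambda>i. if i < length ts then ts ! i else Var (i - length ts))"
  by (auto simp: wfs_def list_all_iff)

lemma wff_fsubst: "wff L as P \<Longrightarrow> wfs L \<sigma> \<Longrightarrow> wff L as (fsubst \<sigma> P)"
  by (induction P arbitrary: as \<sigma>) (auto simp: list_all_wft_tsubst list.pred_map wft_tsubst)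

lemma wff_neg [simp]: "wff L as (neg P) = wff L as P"
  by (induction P arbitrary: as) auto

lemma wff_inst: "wff L as P \<Longrightarrow> list_all (wft L) ts \<Longrightarrow> wff L as (inst ts P)"
  by (simp add: inst_def wff_fsubst wfs_nth)

lemma wff_shift: "wff L as P \<Longrightarrow> wff L as (shift n d P)"
  by (simp add: shift_def wff_fsubst)

lemma wff_append: "wff L as P \<Longrightarrow> wff L (as @ bs) P"
  by (induction P arbitrary: as) (auto simp: nth_append simp flip: append_Cons)

lemma wff_psubst:
  "wff L (bs @ n # cs) P \<Longrightarrow> wff L [] S \<Longrightarrow> wff L (bs @ cs) (psubst n S (length bs) P)"
proof (induction P arbitrary: bs S)
  case (PVar p ts)
  then show ?case
    using wff_append[OF wff_inst, of L "[]" S ts "bs @ cs"] by (auto simp: nth_append)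
next
  case (Mu B ts)
  then show ?case using Mu.IH[of "length ts # bs"] by (simp add: wff_shift)
next
  case (Nu B ts)
  then show ?case using Nu.IH[of "length ts # bs"] by (simp add: wff_shift)
qed (auto simp: wff_shift)

lemma wff_app_op: "wff L [n] B \<Longrightarrow> wff L [] S \<Longrightarrow> wff L [] (app_op n B S)"
  using wff_psubst[of L "[]" n "[]" B] by (simp add: app_op_def wff_shift)

lemma list_all_vars [simp]: "list_all (wft L) (map Var xs)"
  by (simp add: list_all_iff)

lemma wff_unfold_mu: "wff L [] (Mu B ts) \<Longrightarrow> wff L [] (unfold_mu B ts)"
  by (simp add: unfold_mu_def Let_def wff_app_op wff_inst wff_shift)

lemma psubst_closed: "wff L as P \<Longrightarrow> length as \<le> k \<Longrightarrow> psubst n S k P = P"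
proof (induction P arbitrary: as k S)
  case (Mu B ts)
  then show ?case using Mu.IH[of "length ts # as" "Suc k"] by simp
next
  case (Nu B ts)
  then show ?case using Nu.IH[of "length ts # as" "Suc k"] by simp
qed auto

section \<open>Focused derivations\<close>

primrec item_form :: "('f, 'a) item \<Rightarrow> ('f, 'a) form" where
  "item_form (Plain P) = P"
| "item_form (Frozen P) = P"

definition wfc :: "('f, 'a) signature \<Rightarrow> ('f, 'a) item multiset \<Rightarrow> bool" where
  "wfc L \<Gamma> \<longleftrightarrow> (\<forall>I\<in>#\<Gamma>. wff L [] (item_form I))"

lemma wfc_simps [simp]:
  "wfc L {#}"
  "wfc L (add_mset I \<Gamma>) \<longleftrightarrow> wff L [] (item_form I) \<and> wfc L \<Gamma>"
  "wfc L (\<Gamma> + \<Gamma>') \<longleftrightarrow> wfc L \<Gamma> \<and> wfc L \<Gamma>'"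
  by (auto simp: wfc_def)

lemma wfc_isubst: "wfc L \<Gamma> \<Longrightarrow> wfs L \<sigma> \<Longrightarrow> wfc L (image_mset (isubst \<sigma>) \<Gamma>)"
proof (induction \<Gamma>)
  case (add I \<Gamma>)
  then show ?case by (cases I) (auto simp: wff_fsubst)
qed auto

lemma asynchronous_fsubst [simp]: "asynchronous (fsubst \<sigma> P) = asynchronous P"
  by (cases P) auto

lemma synchronous_fsubst [simp]: "synchronous (fsubst \<sigma> P) = synchronous P"
  by (cases P) auto

lemma wff_polarity: "wff L [] P \<Longrightarrow> asynchronous P \<or> synchronous P"
  by (cases P) auto

lemma lift_Suc: "lift (Suc 0) \<sigma> (Suc i) = tsubst (\<lambda>i. Var (Suc i)) (\<sigma> i)"
  by (simp add: lift_def)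

lemma foc_neq_all:
  assumes "\<And>\<theta>. wfs L \<theta> \<Longrightarrow> tsubst \<theta> u = tsubst \<theta> v \<Longrightarrow>
    foc_up L (image_mset (isubst \<theta>) \<Gamma>) (image_mset (fsubst \<theta>) \<Delta>)"
  shows "foc_up L \<Gamma> (add_mset (Neq u v) \<Delta>)"
proof (rule f_neq)
  show "complete_unifiers L u v {\<theta>. wfs L \<theta> \<and> tsubst \<theta> u = tsubst \<theta> v}"
    by (force simp: complete_unifiers_def intro: exI[of _ Var])
qed (auto simp: assms)

lemma foc_subst:
  "foc_up L \<Gamma> \<Delta> \<Longrightarrow> wfc L \<Gamma> \<Longrightarrow> \<forall>P\<in>#\<Delta>. wff L [] P \<Longrightarrow> wfs L \<sigma> \<Longrightarrow>
    foc_up L (image_mset (isubst \<sigma>) \<Gamma>) (image_mset (fsubst \<sigma>) \<Delta>)"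
  "foc_down L \<Gamma> P \<Longrightarrow> wfc L \<Gamma> \<Longrightarrow> wff L [] P \<Longrightarrow> wfs L \<sigma> \<Longrightarrow>
    foc_down L (image_mset (isubst \<sigma>) \<Gamma>) (fsubst \<sigma> P)"
proof (induction arbitrary: \<sigma> and \<sigma> rule: foc_up_foc_down.inducts)
  case (f_all \<Gamma> P \<Delta>)
  have "foc_up L (image_mset (isubst (lift 1 \<sigma>)) (image_mset (isubst (\<lambda>i. Var (Suc i))) \<Gamma>))
    (image_mset (fsubst (lift 1 \<sigma>)) (add_mset P (image_mset (fsubst (\<lambda>i. Var (Suc i))) \<Delta>)))"
    by (rule f_all.IH) (use f_all.prems in \<open>auto simp: wfc_isubst wff_fsubst\<close>)
  then show ?case
    by (auto intro!: foc_up_foc_down.f_all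
        simp: image_mset_fsubst_fsubst image_mset_isubst_isubst lift_Suc)
next
  case (f_neq u v U \<Gamma> \<Delta>)
  show ?case
    unfolding image_mset_add_mset fsubst.simps
  proof (rule foc_neq_all)
    fix \<theta> assume th: "wfs L \<theta>" "tsubst \<theta> (tsubst \<sigma> u) = tsubst \<theta> (tsubst \<sigma> v)"
    define \<sigma>' where "\<sigma>' = (\<lambda>i. tsubst \<theta> (\<sigma> i))"
    have "wfs L \<sigma>'" "tsubst \<sigma>' u = tsubst \<sigma>' v"
      using th f_neq.prems by (auto simp: \<sigma>'_def wfs_comp tsubst_tsubst)
    then obtain \<theta>' \<tau> where *: "\<theta>' \<in> U" "wfs L \<tau>" "\<And>i. \<sigma>' i = tsubst \<tau> (\<theta>' i)"
      using f_neq(1) unfolding complete_unifiers_def by blast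
    then have "wfs L \<theta>'" using f_neq(1) unfolding complete_unifiers_def by blast
    then have "foc_up L (image_mset (isubst \<tau>) (image_mset (isubst \<theta>') \<Gamma>))
      (image_mset (fsubst \<tau>) (image_mset (fsubst \<theta>') \<Delta>))"
      using f_neq(3)[OF *(1), of \<tau>] f_neq.prems * by (auto simp: wfc_isubst wff_fsubst)
    then show "foc_up L (image_mset (isubst \<theta>) (image_mset (isubst \<sigma>) \<Gamma>))
      (image_mset (fsubst \<theta>) (image_mset (fsubst \<sigma>) \<Delta>))"
      by (simp add: image_mset_fsubst_fsubst image_mset_isubst_isubst *(3)[unfolded \<sigma>'_def])
  qed
next
  case (f_nu S \<Gamma> ts \<Delta> B)
  let ?n = "length ts"
  have up: "foc_up L (image_mset (isubst \<sigma>) \<Gamma>) (add_mset (fsubst \<sigma> (inst ts S)) (image_mset (fsubst \<sigma>) \<Delta>))"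
    using f_nu(3)[of \<sigma>] f_nu.prems f_nu(1) by (auto simp: wff_inst)
  have B: "wff L [?n] B" using f_nu.prems by simp
  have "foc_up L {#} {#fsubst (lift ?n \<sigma>) (app_op ?n B S), fsubst (lift ?n \<sigma>) (neg S)#}"
    using f_nu(5)[of "lift ?n \<sigma>"] f_nu.prems f_nu(1) by (auto simp: wff_app_op)
  then have "foc_up L {#} {#app_op ?n (fsubst (lift ?n \<sigma>) B) (fsubst (lift ?n \<sigma>) S),
      neg (fsubst (lift ?n \<sigma>) S)#}"
    by (simp add: fsubst_app_op[OF B])
  then show ?case
    using up f_nu(1) f_nu.prems
    by (auto intro!: foc_up_foc_down.f_nu[where S = "fsubst (lift ?n \<sigma>) S"] simp: fsubst_inst wff_fsubst)
next
  case (f_ex t \<Gamma> P)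
  have "foc_down L (image_mset (isubst \<sigma>) \<Gamma>) (fsubst \<sigma> (inst [t] P))"
    using f_ex by (auto simp: wff_inst)
  then show ?case
    using f_ex by (auto intro!: foc_up_foc_down.f_ex[of L "tsubst \<sigma> t"] simp: wft_tsubst fsubst_inst)
next
  case (f_mu \<Gamma> B ts)
  then have "foc_down L (image_mset (isubst \<sigma>) \<Gamma>) (fsubst \<sigma> (unfold_mu B ts))"
    using wff_unfold_mu[of L B ts] by auto
  then show ?case
    using f_mu.prems by (auto intro!: foc_up_foc_down.f_mu simp: fsubst_unfold_mu)
next
  case (f_store P \<Gamma> \<Delta>)
  then show ?case by (auto intro!: foc_up_foc_down.f_store)
next
  case (f_mu_init B ts)
  then show ?case
    using foc_up_foc_down.f_mu_init[of L "fsubst (lift (length ts) \<sigma>) B"] by simp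
qed (auto intro: foc_up_foc_down.intros)

definition provides ::
  "('f, 'a) signature \<Rightarrow> ('f, 'a) form \<Rightarrow> ('f, 'a) item multiset \<Rightarrow> ('f, 'a) form multiset \<Rightarrow> bool"
where
  "provides L X \<Gamma> \<Delta> \<longleftrightarrow> (\<forall>\<rho> \<Gamma>'. wfs L \<rho> \<longrightarrow> wfc L \<Gamma>' \<longrightarrow> foc_down L \<Gamma>' (fsubst \<rho> X) \<longrightarrow>
     foc_up L (image_mset (isubst \<rho>) \<Gamma> + \<Gamma>') (image_mset (fsubst \<rho>) \<Delta>))"

lemma providesI:
  "(\<And>\<rho> \<Gamma>'. wfs L \<rho> \<Longrightarrow> wfc L \<Gamma>' \<Longrightarrow> foc_down L \<Gamma>' (fsubst \<rho> X) \<Longrightarrow>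
     foc_up L (image_mset (isubst \<rho>) \<Gamma> + \<Gamma>') (image_mset (fsubst \<rho>) \<Delta>)) \<Longrightarrow> provides L X \<Gamma> \<Delta>"
  by (simp add: provides_def)

lemma providesD:
  "provides L X \<Gamma> \<Delta> \<Longrightarrow> wfs L \<rho> \<Longrightarrow> wfc L \<Gamma>' \<Longrightarrow> foc_down L \<Gamma>' (fsubst \<rho> X) \<Longrightarrow>
     foc_up L (image_mset (isubst \<rho>) \<Gamma> + \<Gamma>') (image_mset (fsubst \<rho>) \<Delta>)"
  by (simp add: provides_def)

lemma provides_now:
  "provides L X \<Gamma> \<Delta> \<Longrightarrow> wfc L \<Gamma>' \<Longrightarrow> foc_down L \<Gamma>' X \<Longrightarrow> foc_up L (\<Gamma> + \<Gamma>') \<Delta>"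
  using providesD[of L X \<Gamma> \<Delta> Var \<Gamma>'] by simp

lemma provides_subst:
  assumes "provides L X \<Gamma> \<Delta>" "wfs L \<tau>"
  shows "provides L (fsubst \<tau> X) (image_mset (isubst \<tau>) \<Gamma>) (image_mset (fsubst \<tau>) \<Delta>)"
proof (rule providesI)
  fix \<rho> \<Gamma>' assume "wfs L \<rho>" "wfc L \<Gamma>'" "foc_down L \<Gamma>' (fsubst \<rho> (fsubst \<tau> X))"
  then show "foc_up L (image_mset (isubst \<rho>) (image_mset (isubst \<tau>) \<Gamma>) + \<Gamma>')
      (image_mset (fsubst \<rho>) (image_mset (fsubst \<tau>) \<Delta>))"
    using providesD[OF assms(1) wfs_comp[OF _ assms(2)]]
    by (simp add: fsubst_fsubst image_mset_fsubst_fsubst image_mset_isubst_isubst)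
qed

lemma decide_provides:
  assumes "synchronous P"
    and "\<And>\<rho> \<Gamma>. wfs L \<rho> \<Longrightarrow> wfc L \<Gamma> \<Longrightarrow> foc_down L \<Gamma> (fsubst \<rho> X) \<Longrightarrow> foc_down L \<Gamma> (fsubst \<rho> P)"
  shows "provides L X {#Plain P#} {#}"
  using assms by (auto intro!: providesI f_decide)

lemma stored_provides:
  "foc_up L \<Gamma>0 \<Delta> \<Longrightarrow> \<Gamma>0 = add_mset (Plain C) \<Gamma> \<Longrightarrow> wfc L \<Gamma>0 \<Longrightarrow> \<forall>P\<in>#\<Delta>. wff L [] P \<Longrightarrow>
    provides L C \<Gamma>' {#} \<Longrightarrow> foc_up L (\<Gamma> + \<Gamma>') \<Delta>"
  "foc_down L \<Gamma>0 P \<Longrightarrow> \<Gamma>0 = add_mset (Plain C) \<Gamma> \<Longrightarrow> wfc L \<Gamma>0 \<Longrightarrow> wff L [] P \<Longrightarrow>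
    provides L C \<Gamma>' {#} \<Longrightarrow> foc_down L (\<Gamma> + \<Gamma>') P"
proof (induction arbitrary: C \<Gamma> \<Gamma>' and C \<Gamma> \<Gamma>' rule: foc_up_foc_down.inducts)
  case (f_all \<Gamma>0 P \<Delta>)
  have "foc_up L (image_mset (isubst (\<lambda>i. Var (Suc i))) \<Gamma> + image_mset (isubst (\<lambda>i. Var (Suc i))) \<Gamma>')
    (add_mset P (image_mset (fsubst (\<lambda>i. Var (Suc i))) \<Delta>))"
    by (rule f_all(2)[where C = "fsubst (\<lambda>i. Var (Suc i)) C"])
       (use f_all.prems provides_subst[OF f_all.prems(4), of "\<lambda>i. Var (Suc i)"] in
        \<open>auto simp: wfc_isubst wff_fsubst\<close>)
  then show ?case by (auto intro!: foc_up_foc_down.f_all)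
next
  case (f_neq u v U \<Gamma>0 \<Delta>)
  show ?case
  proof (rule foc_up_foc_down.f_neq[OF f_neq(1)])
    fix \<theta> assume \<theta>: "\<theta> \<in> U"
    then have wf: "wfs L \<theta>" using f_neq(1) unfolding complete_unifiers_def by blast
    show "foc_up L (image_mset (isubst \<theta>) (\<Gamma> + \<Gamma>')) (image_mset (fsubst \<theta>) \<Delta>)"
      unfolding image_mset_union
      by (rule f_neq(3)[OF \<theta>, where C = "fsubst \<theta> C"])
         (use f_neq.prems wf provides_subst[OF f_neq.prems(4), of \<theta>] in
          \<open>auto simp: wfc_isubst wff_fsubst\<close>)
  qed
next
  case (f_nu S \<Gamma>0 ts \<Delta> B)
  then show ?case
    by (auto intro!: foc_up_foc_down.f_nu[of L S] simp: wff_inst)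
next
  case (f_freeze_nu B ts \<Gamma>0 \<Delta>)
  then show ?case
    using f_freeze_nu(2)[of C "add_mset (Frozen (Nu B ts)) \<Gamma>" \<Gamma>']
    by (auto intro!: foc_up_foc_down.f_freeze_nu)
next
  case (f_freeze_natom a ts \<Gamma>0 \<Delta>)
  then show ?case
    using f_freeze_natom(2)[of C "add_mset (Frozen (NAtom a ts)) \<Gamma>" \<Gamma>']
    by (auto intro!: foc_up_foc_down.f_freeze_natom)
next
  case (f_store P \<Gamma>0 \<Delta>)
  then show ?case
    using f_store(3)[of C "add_mset (Plain P) \<Gamma>" \<Gamma>']
    by (auto intro!: foc_up_foc_down.f_store)
next
  case (f_decide P \<Gamma>0)
  show ?case
  proof (cases "P = C")
    case True
    then show ?thesis
      using f_decide provides_now[of L C \<Gamma>' "{#}" \<Gamma>] by (simp add: add.commute)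
  next
    case False
    then obtain \<Gamma>1 where *: "\<Gamma>0 = add_mset (Plain C) \<Gamma>1" "\<Gamma> = add_mset (Plain P) \<Gamma>1"
      using f_decide.prems(1) by (auto simp: add_eq_conv_ex)
    then show ?thesis
      using f_decide by (auto intro!: foc_up_foc_down.f_decide)
  qed
next
  case (f_tensor \<Gamma>1 P \<Gamma>2 Q)
  have "Plain C \<in># \<Gamma>1 \<or> Plain C \<in># \<Gamma>2"
    using f_tensor.prems(1) by (metis union_iff union_single_eq_member)
  then show ?case
  proof
    assume "Plain C \<in># \<Gamma>1"
    then obtain \<Gamma>3 where *: "\<Gamma>1 = add_mset (Plain C) \<Gamma>3" by (metis mset_add)
    then have "foc_down L ((\<Gamma>3 + \<Gamma>') + \<Gamma>2) (Tensor P Q)"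
      using f_tensor by (intro foc_up_foc_down.f_tensor) auto
    then show ?thesis using * f_tensor.prems(1) by (auto simp: ac_simps)
  next
    assume "Plain C \<in># \<Gamma>2"
    then obtain \<Gamma>3 where *: "\<Gamma>2 = add_mset (Plain C) \<Gamma>3" by (metis mset_add)
    then have "foc_down L (\<Gamma>1 + (\<Gamma>3 + \<Gamma>')) (Tensor P Q)"
      using f_tensor by (intro foc_up_foc_down.f_tensor) auto
    then show ?thesis using * f_tensor.prems(1) by (auto simp: ac_simps)
  qed
next
  case (f_ex t \<Gamma>0 P)
  then show ?case by (auto intro!: foc_up_foc_down.f_ex[of L t] simp: wff_inst)
next
  case (f_mu \<Gamma>0 B ts)
  then show ?case using wff_unfold_mu[of L B ts] by (auto intro!: foc_up_foc_down.f_mu)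
qed (auto intro: foc_up_foc_down.intros)

text \<open>
  The effect of a premise \<open>C\<close> of a synchronous rule: its derivation may work on other formulas
  first, so the rule is applied wherever \<open>C\<close> finally gets the focus.
\<close>

lemma foc_up_provides:
  assumes "foc_up L \<Gamma> {#C#}" "wfc L \<Gamma>" "wff L [] C" "provides L C \<Gamma>' {#}"
  shows "foc_up L (\<Gamma> + \<Gamma>') {#}"
proof (cases "asynchronous C")
  case True
  then have "foc_down L \<Gamma> C" using assms(1) by (rule f_release)
  then show ?thesis using provides_now[OF assms(4,2)] by (simp add: add.commute)
next
  case False
  then have C: "synchronous C" using wff_polarity[OF assms(3)] by blast
  from assms(1) False have "foc_up L (add_mset (Plain C) \<Gamma>) {#}"
    by (cases rule: foc_up.cases) auto
  then show ?thesis using stored_provides(1)[OF _ refl _ _ assms(4)] assms by simp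
qed

abbreviation delay :: "('f, 'a) form \<Rightarrow> ('f, 'a) form" where
  "delay P \<equiv> Plus P Zero"

lemma foc_thaw:
  "foc_up L \<Gamma>0 \<Delta> \<Longrightarrow> \<Gamma>0 = add_mset (Frozen (Nu B ts)) \<Gamma> \<Longrightarrow>
    foc_up L (add_mset (Plain (delay (Nu B ts))) \<Gamma>) \<Delta>"
  "foc_down L \<Gamma>0 P \<Longrightarrow> True"
proof (induction arbitrary: B ts \<Gamma> rule: foc_up_foc_down.inducts)
  case (f_decide P \<Gamma>0)
  then have "foc_up L (add_mset (Frozen (Nu B ts)) \<Gamma>) {#}"
    using foc_up_foc_down.f_decide by metis
  then show ?case
    by (auto intro!: foc_up_foc_down.f_decide f_plus1 f_release f_freeze_nu)
next
  case (f_store P \<Gamma>0 \<Delta>)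
  then have "foc_up L (add_mset (Plain (delay (Nu B ts))) (add_mset (Plain P) \<Gamma>)) \<Delta>" by simp
  then show ?case using f_store(1) by (auto intro!: foc_up_foc_down.f_store simp: add_mset_commute)
next
  case (f_freeze_nu B' ts' \<Gamma>0 \<Delta>)
  then have "foc_up L (add_mset (Plain (delay (Nu B ts))) (add_mset (Frozen (Nu B' ts')) \<Gamma>)) \<Delta>" by simp
  then show ?case by (auto intro!: foc_up_foc_down.f_freeze_nu simp: add_mset_commute)
next
  case (f_freeze_natom a ts' \<Gamma>0 \<Delta>)
  then have "foc_up L (add_mset (Plain (delay (Nu B ts))) (add_mset (Frozen (NAtom a ts')) \<Gamma>)) \<Delta>" by simp
  then show ?case by (auto intro!: foc_up_foc_down.f_freeze_natom simp: add_mset_commute)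
qed (auto intro: foc_up_foc_down.intros)

section \<open>Identities between unequal fixed points\<close>

text \<open>
  For \<open>X = neg A\<close> this is identity expansion in continuation-passing style: with \<open>provides\<close> as
  the continuation, \<open>A\<close> can be decomposed in the presence of an arbitrary \<open>\<Delta>\<close>.
\<close>

definition expands ::
  "('f, 'a) signature \<Rightarrow> ('f, 'a) form \<Rightarrow> ('f, 'a) form \<Rightarrow> bool" where
  "expands L A X \<longleftrightarrow> (\<forall>\<tau> \<Gamma> \<Delta>. wfs L \<tau> \<longrightarrow> provides L (fsubst \<tau> X) \<Gamma> \<Delta> \<longrightarrow>
     foc_up L \<Gamma> (add_mset (fsubst \<tau> A) \<Delta>))"

lemma expandsI:
  "(\<And>\<tau> \<Gamma> \<Delta>. wfs L \<tau> \<Longrightarrow> provides L (fsubst \<tau> X) \<Gamma> \<Delta> \<Longrightarrow> foc_up L \<Gamma> (add_mset (fsubst \<tau> A) \<Delta>))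
   \<Longrightarrow> expands L A X"
  by (simp add: expands_def)

lemma expandsD:
  "expands L A X \<Longrightarrow> wfs L \<tau> \<Longrightarrow> provides L (fsubst \<tau> X) \<Gamma> \<Delta> \<Longrightarrow>
   foc_up L \<Gamma> (add_mset (fsubst \<tau> A) \<Delta>)"
  by (simp add: expands_def)

lemma expands_now: "expands L A X \<Longrightarrow> provides L X \<Gamma> \<Delta> \<Longrightarrow> foc_up L \<Gamma> (add_mset A \<Delta>)"
  using expandsD[of L A X Var] by simp

lemma expands_swap:
  assumes "expands L A X" "asynchronous A" "synchronous X" "wff L [] X"
  shows "expands L X A"
proof (rule expandsI)
  fix \<tau> \<Gamma> \<Delta> assume \<tau>: "wfs L \<tau>" and K: "provides L (fsubst \<tau> A) \<Gamma> \<Delta>"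
  have "foc_up L {#Plain (fsubst \<tau> X)#} {#fsubst \<tau> A#}"
    by (rule expandsD[OF assms(1) \<tau>]) (auto intro: decide_provides simp: assms)
  then have "foc_down L {#Plain (fsubst \<tau> X)#} (fsubst \<tau> A)"
    using assms by (auto intro: f_release)
  from provides_now[OF K _ this] show "foc_up L \<Gamma> (add_mset (fsubst \<tau> X) \<Delta>)"
    using assms \<tau> by (auto intro!: f_store simp: wff_fsubst)
qed

lemma expands_par:
  assumes "expands L C C'" "expands L D D'" "wff L [] C'"
  shows "expands L (Par C D) (Tensor C' D')"
proof (rule expandsI)
  fix \<tau> \<Gamma> \<Delta> assume \<tau>: "wfs L \<tau>" and K: "provides L (fsubst \<tau> (Tensor C' D')) \<Gamma> \<Delta>"
  have "foc_up L \<Gamma> (add_mset (fsubst \<tau> C) (add_mset (fsubst \<tau> D) \<Delta>))"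
  proof (rule expandsD[OF assms(1) \<tau>], rule providesI)
    fix \<rho> \<Gamma>1 assume \<rho>: "wfs L \<rho>" and 1: "wfc L \<Gamma>1" "foc_down L \<Gamma>1 (fsubst \<rho> (fsubst \<tau> C'))"
    let ?\<sigma> = "\<lambda>i. tsubst \<rho> (\<tau> i)"
    have "foc_up L (image_mset (isubst \<rho>) \<Gamma> + \<Gamma>1) (add_mset (fsubst ?\<sigma> D) (image_mset (fsubst \<rho>) \<Delta>))"
    proof (rule expandsD[OF assms(2) wfs_comp[OF \<rho> \<tau>]], rule providesI)
      fix \<rho>' \<Gamma>2
      assume \<rho>': "wfs L \<rho>'" and 2: "wfc L \<Gamma>2" "foc_down L \<Gamma>2 (fsubst \<rho>' (fsubst ?\<sigma> D'))"
      have "foc_down L (image_mset (isubst \<rho>') \<Gamma>1) (fsubst \<rho>' (fsubst \<rho> (fsubst \<tau> C')))"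
        using foc_subst(2)[OF 1(2,1) _ \<rho>'] assms(3) \<tau> \<rho> by (auto simp: wff_fsubst)
      then have "foc_down L (image_mset (isubst \<rho>') \<Gamma>1 + \<Gamma>2)
          (fsubst (\<lambda>i. tsubst \<rho>' (\<rho> i)) (fsubst \<tau> (Tensor C' D')))"
        using 2(2) by (auto intro!: f_tensor simp: fsubst_fsubst tsubst_tsubst)
      from providesD[OF K wfs_comp[OF \<rho>' \<rho>] _ this]
      show "foc_up L (image_mset (isubst \<rho>') (image_mset (isubst \<rho>) \<Gamma> + \<Gamma>1) + \<Gamma>2)
          (image_mset (fsubst \<rho>') (image_mset (fsubst \<rho>) \<Delta>))"
        using 1 2 \<rho>'
        by (simp add: wfc_isubst image_mset_fsubst_fsubst image_mset_isubst_isubst add.assoc)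
    qed
    then show "foc_up L (image_mset (isubst \<rho>) \<Gamma> + \<Gamma>1)
        (image_mset (fsubst \<rho>) (add_mset (fsubst \<tau> D) \<Delta>))"
      by (simp add: fsubst_fsubst)
  qed
  then show "foc_up L \<Gamma> (add_mset (fsubst \<tau> (Par C D)) \<Delta>)" by (auto intro: f_par)
qed

lemma provides_mono:
  assumes "provides L X \<Gamma> \<Delta>"
    and "\<And>\<rho> \<Gamma>. wfs L \<rho> \<Longrightarrow> wfc L \<Gamma> \<Longrightarrow> foc_down L \<Gamma> (fsubst \<rho> Y) \<Longrightarrow> foc_down L \<Gamma> (fsubst \<rho> X)"
  shows "provides L Y \<Gamma> \<Delta>"
  using assms by (auto simp: provides_def)

lemma expands_with:
  assumes "expands L C C'" "expands L D D'"
  shows "expands L (With C D) (Plus C' D')"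
proof (rule expandsI)
  fix \<tau> \<Gamma> \<Delta> assume \<tau>: "wfs L \<tau>" and K: "provides L (fsubst \<tau> (Plus C' D')) \<Gamma> \<Delta>"
  have "provides L (fsubst \<tau> C') \<Gamma> \<Delta>" "provides L (fsubst \<tau> D') \<Gamma> \<Delta>"
    by (auto intro!: provides_mono[OF K] intro: f_plus1 f_plus2)
  then show "foc_up L \<Gamma> (add_mset (fsubst \<tau> (With C D)) \<Delta>)"
    using assms \<tau> by (auto intro!: f_with expandsD)
qed

lemma image_mset_isubst_Suc:
  "image_mset (isubst \<rho>) (image_mset (isubst (\<lambda>i. Var (Suc i))) \<Gamma>) = image_mset (isubst (\<rho> \<circ> Suc)) \<Gamma>"
  by (simp add: image_mset_isubst_isubst comp_def)

lemma image_mset_fsubst_Suc: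
  "image_mset (fsubst \<rho>) (image_mset (fsubst (\<lambda>i. Var (Suc i))) \<Gamma>) = image_mset (fsubst (\<rho> \<circ> Suc)) \<Gamma>"
  by (simp add: image_mset_fsubst_fsubst comp_def)

lemma wfs_comp_Suc: "wfs L \<rho> \<Longrightarrow> wfs L (\<rho> \<circ> Suc)"
  by (simp add: wfs_def)

lemma inst_fsubst_lift:
  "inst [\<rho> 0] (fsubst (lift (Suc 0) (\<rho> \<circ> Suc)) P) = fsubst \<rho> P"
proof -
  have "case_nat (\<rho> 0) (\<rho> \<circ> Suc) = \<rho>" by (auto split: nat.split)
  then show ?thesis by (simp add: inst_lift)
qed

lemma expands_forall:
  assumes "expands L C C'"
  shows "expands L (Forall C) (Exists C')"
proof (rule expandsI)
  fix \<tau> \<Gamma> \<Delta> assume \<tau>: "wfs L \<tau>" and K: "provides L (fsubst \<tau> (Exists C')) \<Gamma> \<Delta>"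
  have "foc_up L (image_mset (isubst (\<lambda>i. Var (Suc i))) \<Gamma>)
    (add_mset (fsubst (lift 1 \<tau>) C) (image_mset (fsubst (\<lambda>i. Var (Suc i))) \<Delta>))"
  proof (rule expandsD[OF assms wfs_lift[OF \<tau>]], rule providesI)
    fix \<rho> \<Gamma>1
    assume \<rho>: "wfs L \<rho>" and 1: "wfc L \<Gamma>1" "foc_down L \<Gamma>1 (fsubst \<rho> (fsubst (lift 1 \<tau>) C'))"
    have "foc_down L \<Gamma>1 (inst [\<rho> 0] (fsubst (lift (Suc 0) (\<rho> \<circ> Suc)) (fsubst (lift 1 \<tau>) C')))"
      using 1(2) by (simp only: inst_fsubst_lift)
    then have "foc_down L \<Gamma>1 (fsubst (\<rho> \<circ> Suc) (fsubst \<tau> (Exists C')))"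
      using \<rho> by (auto intro!: f_ex[of L "\<rho> 0"] simp: wfs_def)
    from providesD[OF K wfs_comp_Suc[OF \<rho>] 1(1) this]
    show "foc_up L (image_mset (isubst \<rho>) (image_mset (isubst (\<lambda>i. Var (Suc i))) \<Gamma>) + \<Gamma>1)
      (image_mset (fsubst \<rho>) (image_mset (fsubst (\<lambda>i. Var (Suc i))) \<Delta>))"
      by (simp add: image_mset_isubst_Suc image_mset_fsubst_Suc)
  qed
  then show "foc_up L \<Gamma> (add_mset (fsubst \<tau> (Forall C)) \<Delta>)" by (auto intro: f_all)
qed

lemma expands_neq: "expands L (Neq u v) (Eq u v)"
proof (rule expandsI)
  fix \<tau> \<Gamma> \<Delta> assume K: "provides L (fsubst \<tau> (Eq u v)) \<Gamma> \<Delta>"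
  show "foc_up L \<Gamma> (add_mset (fsubst \<tau> (Neq u v)) \<Delta>)"
    unfolding fsubst.simps
  proof (rule foc_neq_all)
    fix \<theta> assume "wfs L \<theta>" "tsubst \<theta> (tsubst \<tau> u) = tsubst \<theta> (tsubst \<tau> v)"
    then show "foc_up L (image_mset (isubst \<theta>) \<Gamma>) (image_mset (fsubst \<theta>) \<Delta>)"
      using providesD[OF K, of \<theta> "{#}"] by (simp add: f_eq)
  qed
qed

lemma expands_bot: "expands L Bot One"
  by (rule expandsI) (auto intro!: f_bot dest: provides_now[of _ _ _ _ "{#}"] intro: f_one)

lemma expands_top: "expands L Top Zero"
  by (rule expandsI) (auto intro!: f_top)

lemma expands_natom:
  assumes "wff L [] (NAtom a ts)"
  shows "expands L (NAtom a ts) (Atom a ts)"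
proof (rule expandsI)
  fix \<tau> \<Gamma> \<Delta> assume \<tau>: "wfs L \<tau>" and K: "provides L (fsubst \<tau> (Atom a ts)) \<Gamma> \<Delta>"
  have "wff L [] (fsubst \<tau> (NAtom a ts))" using assms \<tau> by (rule wff_fsubst)
  then show "foc_up L \<Gamma> (add_mset (fsubst \<tau> (NAtom a ts)) \<Delta>)"
    using provides_now[OF K, of "{#Frozen (fsubst \<tau> (NAtom a ts))#}"]
    by (auto intro!: f_freeze_natom f_atom_init)
qed

lemma foc_up_frozen_nu:
  assumes "provides L (Mu B ts) \<Gamma> \<Delta>" "wff L [] (Mu B ts)"
  shows "foc_up L (add_mset (Frozen (Nu (neg B) ts)) \<Gamma>) \<Delta>"
  using provides_now[OF assms(1), of "{#Frozen (Nu (neg B) ts)#}"] assms(2)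
  by (auto intro: f_mu_init)

lemma wff_fsubst_Mu:
  "wff L [] (Mu B ts) \<Longrightarrow> wfs L \<tau> \<Longrightarrow>
   wff L [] (Mu (fsubst (lift (length ts) \<tau>) B) (map (tsubst \<tau>) ts))"
  using wff_fsubst[of L "[]" "Mu B ts" \<tau>] by simp

lemma expands_init:
  assumes "wff L [] (Mu B ts)"
  shows "expands L (Nu (neg B) ts) (Mu B ts)"
  by (rule expandsI)
     (use wff_fsubst_Mu[OF assms] foc_up_frozen_nu in \<open>fastforce intro: f_freeze_nu\<close>)

lemma expands_delay:
  assumes "wff L [] (Mu B ts)"
  shows "expands L (delay (Nu (neg B) ts)) (Mu B ts)"
    and "expands L (Mu B ts) (delay (Nu (neg B) ts))"
proof -
  show "expands L (delay (Nu (neg B) ts)) (Mu B ts)"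
  proof (rule expandsI)
    fix \<tau> \<Gamma> \<Delta> assume \<tau>: "wfs L \<tau>" and K: "provides L (fsubst \<tau> (Mu B ts)) \<Gamma> \<Delta>"
    from foc_thaw(1)[OF foc_up_frozen_nu[OF K[unfolded fsubst.simps] wff_fsubst_Mu[OF assms \<tau>]] refl]
    show "foc_up L \<Gamma> (add_mset (fsubst \<tau> (delay (Nu (neg B) ts))) \<Delta>)"
      by (auto intro!: f_store)
  qed
  show "expands L (Mu B ts) (delay (Nu (neg B) ts))"
  proof (rule expandsI)
    fix \<tau> \<Gamma> \<Delta> assume \<tau>: "wfs L \<tau>" and K: "provides L (fsubst \<tau> (delay (Nu (neg B) ts))) \<Gamma> \<Delta>"
    let ?B = "fsubst (lift (length ts) \<tau>) B" and ?ts = "map (tsubst \<tau>) ts"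
    have "foc_down L {#Frozen (Nu (neg ?B) ?ts)#} (Mu ?B ?ts)" by (rule f_mu_init)
    then have "foc_up L {#Plain (Mu ?B ?ts), Frozen (Nu (neg ?B) ?ts)#} {#}" by (auto intro: f_decide)
    then have "foc_up L {#Plain (Mu ?B ?ts)#} {#Nu (neg ?B) ?ts#}"
      by (auto intro!: f_freeze_nu simp: add_mset_commute)
    then have "foc_down L {#Plain (Mu ?B ?ts)#} (delay (Nu (neg ?B) ?ts))"
      by (auto intro!: f_plus1 f_release)
    then show "foc_up L \<Gamma> (add_mset (fsubst \<tau> (Mu B ts)) \<Delta>)"
      using provides_now[OF K, of "{#Plain (Mu ?B ?ts)#}"] wff_fsubst_Mu[OF assms \<tau>]
      by (auto intro!: f_store)
  qed
qed

lemma provides_unfold_mu: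
  assumes "wff L [length ts] B"
  shows "provides L (unfold_mu B ts) {#Plain (Mu B ts)#} {#}"
  by (rule decide_provides) (auto simp: fsubst_unfold_mu[OF assms] intro: f_mu)

text \<open>
  The relation pairs formulas that are dual up to exchanging \<open>Nu B ts\<close> and \<open>delay (Nu B ts)\<close>. The
  index bounds the nesting of fixed points whose bodies are compared; it is what makes induction
  through the unfolding of a fixed point possible.
\<close>

inductive dual_pair :: "('f, 'a) signature \<Rightarrow> nat \<Rightarrow> ('f, 'a) form \<Rightarrow> ('f, 'a) form \<Rightarrow> bool"
  for L where
  dp_sym: "dual_pair L k A X \<Longrightarrow> dual_pair L k X A"
| dp_natom: "dual_pair L k (NAtom a ts) (Atom a ts)"
| dp_pvar: "list_all (wft L) ts \<Longrightarrow> dual_pair L k (PVar p ts) (PVar p ts)"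
| dp_neq: "dual_pair L k (Neq u v) (Eq u v)"
| dp_bot: "dual_pair L k Bot One"
| dp_top: "dual_pair L k Top Zero"
| dp_par: "dual_pair L k C C' \<Longrightarrow> dual_pair L k D D' \<Longrightarrow> dual_pair L k (Par C D) (Tensor C' D')"
| dp_with: "dual_pair L k C C' \<Longrightarrow> dual_pair L k D D' \<Longrightarrow> dual_pair L k (With C D) (Plus C' D')"
| dp_forall: "dual_pair L k C C' \<Longrightarrow> dual_pair L k (Forall C) (Exists C')"
| dp_nu: "dual_pair L k C C' \<Longrightarrow> k < m \<Longrightarrow> dual_pair L m (Nu C ts) (Mu C' ts)"
| dp_init: "wff L [length ts] B \<Longrightarrow> dual_pair L k (Nu (neg B) ts) (Mu B ts)"
| dp_delay: "wff L [length ts] B \<Longrightarrow> dual_pair L k (delay (Nu (neg B) ts)) (Mu B ts)"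

lemma dual_pair_mono: "dual_pair L k A X \<Longrightarrow> k \<le> m \<Longrightarrow> dual_pair L m A X"
proof (induction arbitrary: m rule: dual_pair.induct)
  case (dp_nu k C C' m' ts)
  then show ?case by (intro dual_pair.dp_nu[of L k]) auto
qed (auto intro: dual_pair.intros)

lemma dual_pair_fsubst:
  "dual_pair L k A X \<Longrightarrow> wfs L \<sigma> \<Longrightarrow> dual_pair L k (fsubst \<sigma> A) (fsubst \<sigma> X)"
proof (induction arbitrary: \<sigma> rule: dual_pair.induct)
  case (dp_nu k C C' m ts)
  then show ?case by (auto intro!: dual_pair.dp_nu[of L k])
next
  case (dp_init ts B k)
  then show ?case
    using dual_pair.dp_init[of L "map (tsubst \<sigma>) ts" "fsubst (lift (length ts) \<sigma>) B"]
    by (simp add: wff_fsubst)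
next
  case (dp_delay ts B k)
  then show ?case
    using dual_pair.dp_delay[of L "map (tsubst \<sigma>) ts" "fsubst (lift (length ts) \<sigma>) B"]
    by (simp add: wff_fsubst)
qed (auto intro: dual_pair.intros simp: list.pred_map list_all_wft_tsubst)

lemma dual_pair_psubst:
  "dual_pair L k A X \<Longrightarrow> (\<And>j. dual_pair L j S S') \<Longrightarrow>
   dual_pair L k (psubst n S i A) (psubst n S' i X)"
proof (induction arbitrary: i S S' rule: dual_pair.induct)
  case (dp_sym k A X)
  then show ?case by (blast intro: dual_pair.dp_sym)
next
  case (dp_pvar ts k p)
  then show ?case
    by (auto simp: inst_def intro!: dual_pair_fsubst wfs_nth intro: dual_pair.dp_pvar)
next
  case (dp_forall k C C')
  then show ?case
    by (auto intro!: dual_pair.dp_forall dp_forall.IH dual_pair_fsubst simp: shift_def)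
next
  case (dp_nu k C C' m ts)
  then show ?case
    by (auto intro!: dual_pair.dp_nu[of L k] dp_nu.IH dual_pair_fsubst simp: shift_def)
next
  case (dp_init ts B k)
  then show ?case
    using psubst_closed[of L "[length ts]" B "Suc i"] psubst_closed[of L "[length ts]" "neg B" "Suc i"]
    by (auto intro: dual_pair.dp_init)
next
  case (dp_delay ts B k)
  then show ?case
    using psubst_closed[of L "[length ts]" B "Suc i"] psubst_closed[of L "[length ts]" "neg B" "Suc i"]
    by (auto intro: dual_pair.dp_delay)
qed (auto intro: dual_pair.intros)

lemma dual_pair_app_op:
  "dual_pair L k A X \<Longrightarrow> (\<And>j. dual_pair L j S S') \<Longrightarrow>
   dual_pair L k (app_op n A S) (app_op n X S')"
  unfolding app_op_def shift_def by (auto intro!: dual_pair_psubst dual_pair_fsubst)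

lemma dual_pair_neg: "wff L as P \<Longrightarrow> \<exists>k. dual_pair L k P (neg P)"
proof (induction P arbitrary: as)
  case (Mu B ts)
  then obtain k where "dual_pair L k B (neg B)" by auto
  then have "dual_pair L (Suc k) (Nu (neg B) ts) (Mu B ts)" by (auto intro: dp_nu dp_sym)
  then show ?case by (auto intro: dp_sym)
next
  case (Nu B ts)
  then obtain k where "dual_pair L k B (neg B)" by auto
  then have "dual_pair L (Suc k) (Nu B ts) (Mu (neg B) ts)" by (auto intro: dp_nu)
  then show ?case by auto
next
  case (Par P Q)
  then obtain j k where "dual_pair L j P (neg P)" "dual_pair L k Q (neg Q)" by force
  then show ?case by (auto intro!: exI[of _ "max j k"] dp_par intro: dual_pair_mono)
next
  case (Tensor P Q)
  then obtain j k where "dual_pair L j P (neg P)" "dual_pair L k Q (neg Q)" by force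
  then show ?case
    by (auto intro!: exI[of _ "max j k"] dp_sym[OF dp_par] intro: dual_pair_mono dp_sym)
next
  case (With P Q)
  then obtain j k where "dual_pair L j P (neg P)" "dual_pair L k Q (neg Q)" by force
  then show ?case by (auto intro!: exI[of _ "max j k"] dp_with intro: dual_pair_mono)
next
  case (Plus P Q)
  then obtain j k where "dual_pair L j P (neg P)" "dual_pair L k Q (neg Q)" by force
  then show ?case
    by (auto intro!: exI[of _ "max j k"] dp_sym[OF dp_with] intro: dual_pair_mono dp_sym)
next
  case (Exists P)
  then obtain k where "dual_pair L k P (neg P)" by force
  then show ?case by (auto intro!: exI[of _ k] dp_sym[OF dp_forall] intro: dp_sym)
next
  case (Forall P)
  then obtain k where "dual_pair L k P (neg P)" by force
  then show ?case by (auto intro!: exI[of _ k] dp_forall)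
qed (auto intro: dual_pair.intros)

text \<open>
  Freezing \<open>Nu C ts\<close> would not match \<open>Mu C' ts\<close> when \<open>C'\<close> is not exactly \<open>neg C\<close>, hence the
  coinduction with the dual of \<open>Mu C'\<close>, which is then frozen.
\<close>

lemma expands_nu:
  assumes D: "dual_pair L k C C'"
    and IH: "\<And>A X. dual_pair L k A X \<Longrightarrow> wff L [] A \<Longrightarrow> wff L [] X \<Longrightarrow> expands L A X"
    and wf: "wff L [] (Nu C ts)" "wff L [] (Mu C' ts)"
  shows "expands L (Nu C ts) (Mu C' ts)"
proof (rule expandsI)
  fix \<tau> \<Gamma> \<Delta> assume \<tau>: "wfs L \<tau>" and K: "provides L (fsubst \<tau> (Mu C' ts)) \<Gamma> \<Delta>"
  define n where "n = length ts"
  define C1 where "C1 = fsubst (lift n \<tau>) C"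
  define C1' where "C1' = fsubst (lift n \<tau>) C'"
  define us where "us = map (tsubst \<tau>) ts"
  define S where "S = Nu (shift n n (neg C1')) (map Var [0..<n])"
  have len: "length us = n" by (simp add: us_def n_def)
  have K': "provides L (Mu C1' us) \<Gamma> \<Delta>" using K by (simp add: C1'_def us_def n_def)
  have wf': "wff L [] (Mu C1' us)"
    using wff_fsubst_Mu[OF wf(2) \<tau>] by (simp add: C1'_def us_def n_def)
  have wfC: "wff L [n] C1" "wff L [n] C1'"
    using wf \<tau> by (auto simp: C1_def C1'_def n_def wff_fsubst)
  have wfS: "wff L [] S" using wfC by (simp add: S_def wff_shift)
  have "foc_up L (add_mset (Frozen (Nu (neg C1') us)) \<Gamma>) \<Delta>"
    using foc_up_frozen_nu[OF K' wf'] .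
  then have 1: "foc_up L \<Gamma> (add_mset (inst us S) \<Delta>)"
    by (simp add: S_def inst_Nu_vars[OF len] f_freeze_nu)
  have "dual_pair L j S (neg S)" for j
    using dp_init[of L "map Var [0..<n]" "shift n n C1'" j] wfC by (simp add: S_def wff_shift)
  then have "dual_pair L k (app_op n C1 S) (app_op n C1' (neg S))"
    using D \<tau> by (intro dual_pair_app_op) (auto simp: C1_def C1'_def intro: dual_pair_fsubst)
  then have "expands L (app_op n C1 S) (app_op n C1' (neg S))"
    using wfC wfS by (intro IH) (auto intro: wff_app_op)
  moreover have "provides L (app_op n C1' (neg S)) {#Plain (neg S)#} {#}"
    using provides_unfold_mu[of L "map Var [0..<n]" "shift n n C1'"] wfC
    by (simp add: S_def unfold_mu_vars wff_shift)
  ultimately have "foc_up L {#Plain (neg S)#} {#app_op n C1 S#}" by (rule expands_now)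
  then have "foc_up L {#} {#neg S, app_op n C1 S#}" by (auto intro!: f_store simp: S_def)
  then have "foc_up L {#} {#app_op n C1 S, neg S#}" by (simp add: add_mset_commute)
  with 1 wfS have "foc_up L \<Gamma> (add_mset (Nu C1 us) \<Delta>)" by (intro f_nu[of L S]) (auto simp: len)
  then show "foc_up L \<Gamma> (add_mset (fsubst \<tau> (Nu C ts)) \<Delta>)" by (simp add: C1_def us_def n_def)
qed

lemma dual_pair_expands_aux:
  "dual_pair L k A X \<Longrightarrow>
   (\<And>j A X. j < k \<Longrightarrow> dual_pair L j A X \<Longrightarrow> wff L [] A \<Longrightarrow> wff L [] X \<Longrightarrow> expands L A X) \<Longrightarrow>
   wff L [] A \<Longrightarrow> wff L [] X \<Longrightarrow> expands L A X \<and> expands L X A"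
proof (induction rule: dual_pair.induct)
  case (dp_natom k a ts)
  then show ?case using expands_natom[of L a ts] by (auto intro: expands_swap)
next
  case (dp_neq k u v)
  then show ?case using expands_neq[of L u v] by (auto intro: expands_swap)
next
  case (dp_bot k)
  then show ?case using expands_bot[of L] by (auto intro: expands_swap)
next
  case (dp_top k)
  then show ?case using expands_top[of L] by (auto intro: expands_swap)
next
  case (dp_par k C C' D D')
  then have "expands L C C'" "expands L D D'" by auto
  then show ?case using expands_par[of L C C' D D'] dp_par.prems by (auto intro: expands_swap)
next
  case (dp_with k C C' D D')
  then have "expands L C C'" "expands L D D'" by auto
  then show ?case using expands_with[of L C C' D D'] dp_with.prems by (auto intro: expands_swap)
next
  case (dp_forall k C C')
  then have "expands L C C'" by auto
  then show ?case using expands_forall[of L C C'] dp_forall.prems by (auto intro: expands_swap)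
next
  case (dp_nu k C C' m ts)
  then have "expands L (Nu C ts) (Mu C' ts)" by (intro expands_nu[of L k]) auto
  then show ?case using dp_nu.prems by (auto intro: expands_swap)
next
  case (dp_init ts B k)
  then have "expands L (Nu (neg B) ts) (Mu B ts)" by (intro expands_init) auto
  then show ?case using dp_init.prems by (auto intro: expands_swap)
next
  case (dp_delay ts B k)
  then show ?case using expands_delay[of L B ts] by auto
qed auto

lemma dual_pair_expands:
  "dual_pair L k A X \<Longrightarrow> wff L [] A \<Longrightarrow> wff L [] X \<Longrightarrow> expands L A X"
  by (induction k arbitrary: A X rule: less_induct) (use dual_pair_expands_aux in blast)

lemma delay_coinvariant:
  fixes B :: "('f, 'a) form" and n :: nat
  defines "S \<equiv> delay (Nu (shift n n B) (map Var [0..<n]))"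
  assumes B: "wff L [n] B"
  shows "foc_up L {#} {#app_op n B S, neg S#}"
proof -
  define M where "M = Mu (shift n n (neg B)) (map Var [0..<n])"
  obtain k where k: "dual_pair L k B (neg B)" using dual_pair_neg[OF B] by blast
  have wf: "wff L [] S" "wff L [] M" using B by (auto simp: S_def M_def wff_shift)
  have "dual_pair L j S M" for j
    using dp_delay[of L "map Var [0..<n]" "shift n n (neg B)" j] B
    by (simp add: S_def M_def wff_shift)
  then have "dual_pair L k (app_op n B S) (app_op n (neg B) M)"
    using k by (intro dual_pair_app_op)
  then have "expands L (app_op n B S) (app_op n (neg B) M)"
    by (rule dual_pair_expands) (use B wf in \<open>auto intro: wff_app_op\<close>)
  moreover have "provides L (app_op n (neg B) M) {#Plain M#} {#}"
    using provides_unfold_mu[of L "map Var [0..<n]" "shift n n (neg B)"] B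
    by (simp add: M_def unfold_mu_vars wff_shift)
  ultimately have "foc_up L {#Plain M#} {#app_op n B S#}" by (rule expands_now)
  then have "foc_up L {#} (add_mset M {#app_op n B S#})" by (rule f_store[rotated]) (simp add: M_def)
  then have "foc_up L {#} (add_mset (With M Top) {#app_op n B S#})" by (intro f_with f_top)
  moreover have "neg S = With M Top" by (simp add: S_def M_def)
  ultimately show ?thesis by (simp add: add_mset_commute)
qed

section \<open>Completeness\<close>

text \<open>
  \<open>decf L P \<sigma>\<close> collects the contexts to which the asynchronous phase reduces \<open>P\<close> when \<open>\<sigma>\<close> is the
  substitution accumulated by the quantifiers and disequalities of the whole phase. Greatest
  fixed points are neither frozen nor unfolded but delayed.
\<close>

primrec decf :: "('f, 'a) signature \<Rightarrow> ('f, 'a) form \<Rightarrow> 'f subst \<Rightarrow> ('f, 'a) item multiset set" where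
  "decf L (Atom a ts) \<sigma> = {{#Plain (fsubst \<sigma> (Atom a ts))#}}"
| "decf L (NAtom a ts) \<sigma> = {{#Frozen (fsubst \<sigma> (NAtom a ts))#}}"
| "decf L (PVar p ts) \<sigma> = {}"
| "decf L (Eq u v) \<sigma> = {{#Plain (fsubst \<sigma> (Eq u v))#}}"
| "decf L (Neq u v) \<sigma> = (if tsubst \<sigma> u = tsubst \<sigma> v then {{#}} else {})"
| "decf L One \<sigma> = {{#Plain One#}}"
| "decf L Bot \<sigma> = {{#}}"
| "decf L Zero \<sigma> = {{#Plain Zero#}}"
| "decf L Top \<sigma> = {}"
| "decf L (Tensor P Q) \<sigma> = {{#Plain (fsubst \<sigma> (Tensor P Q))#}}"
| "decf L (Par P Q) \<sigma> = decf L P \<sigma> + decf L Q \<sigma>"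
| "decf L (Plus P Q) \<sigma> = {{#Plain (fsubst \<sigma> (Plus P Q))#}}"
| "decf L (With P Q) \<sigma> = decf L P \<sigma> \<union> decf L Q \<sigma>"
| "decf L (Exists P) \<sigma> = {{#Plain (fsubst \<sigma> (Exists P))#}}"
| "decf L (Forall P) \<sigma> = (\<Union>t\<in>{t. wft L t}. decf L P (case_nat t \<sigma>))"
| "decf L (Mu B ts) \<sigma> = {{#Plain (fsubst \<sigma> (Mu B ts))#}}"
| "decf L (Nu B ts) \<sigma> = {{#Plain (delay (fsubst \<sigma> (Nu B ts)))#}}"

definition decs :: "('f, 'a) signature \<Rightarrow> ('f, 'a) form multiset \<Rightarrow> 'f subst \<Rightarrow> ('f, 'a) item multiset set"
  where "decs L \<Gamma> \<sigma> = (\<Sum>P\<in>#\<Gamma>. decf L P \<sigma>)"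

lemma decs_simps [simp]:
  "decs L {#} \<sigma> = {{#}}"
  "decs L (add_mset P \<Gamma>) \<sigma> = decf L P \<sigma> + decs L \<Gamma> \<sigma>"
  "decs L (\<Gamma> + \<Delta>) \<sigma> = decs L \<Gamma> \<sigma> + decs L \<Delta> \<sigma>"
  by (simp_all add: decs_def set_zero)

lemma decf_synchronous: "synchronous P \<Longrightarrow> decf L P \<sigma> = {{#Plain (fsubst \<sigma> P)#}}"
  by (cases P) auto

lemma decf_fsubst: "decf L (fsubst \<tau> P) \<sigma> = decf L P (\<lambda>i. tsubst \<sigma> (\<tau> i))"
proof (induction P arbitrary: \<sigma> \<tau>)
  case (Forall P)
  have "(\<lambda>i. tsubst (case_nat t \<sigma>) (lift (Suc 0) \<tau> i)) = case_nat t (\<lambda>i. tsubst \<sigma> (\<tau> i))" for t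
    by (auto simp: lift_def tsubst_tsubst fun_eq_iff split: nat.split)
  then show ?case by (simp add: Forall)
qed (auto simp: tsubst_tsubst fsubst_fsubst tsubst_lift_lift)

lemma decs_fsubst: "decs L (image_mset (fsubst \<tau>) \<Gamma>) \<sigma> = decs L \<Gamma> (\<lambda>i. tsubst \<sigma> (\<tau> i))"
  by (induction \<Gamma>) (auto simp: decf_fsubst)

lemma decf_isubst:
  "N \<in> decf L P \<sigma> \<Longrightarrow> wfs L \<rho> \<Longrightarrow> image_mset (isubst \<rho>) N \<in> decf L P (\<lambda>i. tsubst \<rho> (\<sigma> i))"
proof (induction P arbitrary: N \<sigma>)
  case (Par P Q)
  then show ?case by (auto elim!: set_plus_elim intro!: set_plus_intro)
next
  case (Neq u v)
  then show ?case by (auto simp flip: tsubst_tsubst split: if_splits)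
next
  case (Forall P)
  then obtain t where t: "wft L t" "N \<in> decf L P (case_nat t \<sigma>)" by auto
  have "(\<lambda>i. tsubst \<rho> (case_nat t \<sigma> i)) = case_nat (tsubst \<rho> t) (\<lambda>i. tsubst \<rho> (\<sigma> i))"
    by (auto split: nat.split)
  then show ?case using Forall.IH[OF t(2)] Forall.prems t(1) wft_tsubst[of L t \<rho>] by fastforce
qed (auto simp: tsubst_tsubst fsubst_fsubst tsubst_lift_lift split: if_splits)

lemma decs_isubst:
  "N \<in> decs L \<Gamma> \<sigma> \<Longrightarrow> wfs L \<rho> \<Longrightarrow> image_mset (isubst \<rho>) N \<in> decs L \<Gamma> (\<lambda>i. tsubst \<rho> (\<sigma> i))"
proof (induction \<Gamma> arbitrary: N)
  case (add P \<Gamma>)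
  then show ?case by (auto elim!: set_plus_elim intro!: set_plus_intro decf_isubst)
qed auto

lemma wfc_decf: "N \<in> decf L P \<sigma> \<Longrightarrow> wff L [] P \<Longrightarrow> wfs L \<sigma> \<Longrightarrow> wfc L N"
proof (induction P arbitrary: N \<sigma>)
  case (Forall P)
  then show ?case by (auto simp: wfs_case_nat)
qed (auto elim!: set_plus_elim split: if_splits
    simp: wff_fsubst list_all_wft_tsubst list.pred_map wft_tsubst)

lemma wfc_decs: "N \<in> decs L \<Gamma> \<sigma> \<Longrightarrow> \<forall>P\<in>#\<Gamma>. wff L [] P \<Longrightarrow> wfs L \<sigma> \<Longrightarrow> wfc L N"
proof (induction \<Gamma> arbitrary: N)
  case (add P \<Gamma>)
  then show ?case by (auto elim!: set_plus_elim dest: wfc_decf)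
qed auto

lemma foc_up_delay:
  assumes "foc_up L (\<Gamma> + {#Plain (delay (Nu B ts))#}) \<Delta>" "wff L [] (Nu B ts)"
  shows "foc_up L \<Gamma> (add_mset (Nu B ts) \<Delta>)"
proof -
  let ?n = "length ts"
  let ?S = "delay (Nu (shift ?n ?n B) (map Var [0..<?n]))"
  show ?thesis
  proof (rule f_nu)
    show "wff L [] ?S" using assms(2) by (simp add: wff_shift)
    show "foc_up L {#} {#app_op ?n B ?S, neg ?S#}"
      by (rule delay_coinvariant) (use assms(2) in auto)
    show "foc_up L \<Gamma> (add_mset (inst ts ?S) \<Delta>)"
      using assms(1) by (auto intro!: f_store simp: inst_Plus inst_Zero inst_Nu_vars)
  qed
qed

lemma decf_reflect:
  assumes "wff L [] P" "wfs L \<tau>"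
    and "\<And>\<rho> N. wfs L \<rho> \<Longrightarrow> N \<in> decf L P (\<lambda>i. tsubst \<rho> (\<tau> i)) \<Longrightarrow>
      foc_up L (image_mset (isubst \<rho>) \<Gamma> + N) (image_mset (fsubst \<rho>) \<Delta>)"
  shows "foc_up L \<Gamma> (add_mset (fsubst \<tau> P) \<Delta>)"
  using assms
proof (induction P arbitrary: \<tau> \<Gamma> \<Delta>)
  case (NAtom a ts)
  then show ?case using NAtom(3)[of Var] by (auto intro!: f_freeze_natom)
next
  case (Neq u v)
  show ?case
    unfolding fsubst.simps
    by (rule foc_neq_all) (use Neq(3)[where N = "{#}"] in \<open>auto simp: tsubst_tsubst\<close>)
next
  case Bot
  then show ?case using Bot(3)[of Var] by (auto intro!: f_bot)
next
  case Top
  then show ?case by (auto intro!: f_top)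
next
  case (Par P Q)
  have "foc_up L \<Gamma> (add_mset (fsubst \<tau> P) (add_mset (fsubst \<tau> Q) \<Delta>))"
  proof (rule Par.IH(1))
    fix \<rho> N assume \<rho>: "wfs L \<rho>" and N: "N \<in> decf L P (\<lambda>i. tsubst \<rho> (\<tau> i))"
    have "foc_up L (image_mset (isubst \<rho>) \<Gamma> + N)
      (add_mset (fsubst (\<lambda>i. tsubst \<rho> (\<tau> i)) Q) (image_mset (fsubst \<rho>) \<Delta>))"
    proof (rule Par.IH(2))
      fix \<rho>' N' assume \<rho>': "wfs L \<rho>'"
        and N': "N' \<in> decf L Q (\<lambda>i. tsubst \<rho>' (tsubst \<rho> (\<tau> i)))"
      have "image_mset (isubst \<rho>') N + N' \<in> decf L (Par P Q) (\<lambda>i. tsubst (\<lambda>i. tsubst \<rho>' (\<rho> i)) (\<tau> i))"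
        using decf_isubst[OF N \<rho>'] N' by (auto simp: tsubst_tsubst intro: set_plus_intro)
      from Par.prems(3)[OF wfs_comp[OF \<rho>' \<rho>] this]
      show "foc_up L (image_mset (isubst \<rho>') (image_mset (isubst \<rho>) \<Gamma> + N) + N')
        (image_mset (fsubst \<rho>') (image_mset (fsubst \<rho>) \<Delta>))"
        by (simp add: image_mset_fsubst_fsubst image_mset_isubst_isubst add.assoc)
    qed (use Par.prems \<rho> in \<open>auto simp: wfs_comp\<close>)
    then show "foc_up L (image_mset (isubst \<rho>) \<Gamma> + N)
      (image_mset (fsubst \<rho>) (add_mset (fsubst \<tau> Q) \<Delta>))"
      by (simp add: fsubst_fsubst)
  qed (use Par.prems in auto)
  then show ?case by (auto intro: f_par)
next
  case (With P Q)
  then show ?case by (auto intro!: f_with)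
next
  case (Forall P)
  have "foc_up L (image_mset (isubst (\<lambda>i. Var (Suc i))) \<Gamma>)
    (add_mset (fsubst (lift 1 \<tau>) P) (image_mset (fsubst (\<lambda>i. Var (Suc i))) \<Delta>))"
  proof (rule Forall.IH)
    fix \<rho> N assume \<rho>: "wfs L \<rho>" and N: "N \<in> decf L P (\<lambda>i. tsubst \<rho> (lift 1 \<tau> i))"
    have "(\<lambda>i. tsubst \<rho> (lift 1 \<tau> i)) = case_nat (\<rho> 0) (\<lambda>i. tsubst (\<rho> \<circ> Suc) (\<tau> i))"
      by (auto simp: lift_def tsubst_tsubst fun_eq_iff comp_def split: nat.split)
    then have "N \<in> decf L (Forall P) (\<lambda>i. tsubst (\<rho> \<circ> Suc) (\<tau> i))"
      using N \<rho> by (auto simp: wfs_def)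
    from Forall.prems(3)[OF wfs_comp_Suc[OF \<rho>] this]
    show "foc_up L (image_mset (isubst \<rho>) (image_mset (isubst (\<lambda>i. Var (Suc i))) \<Gamma>) + N)
      (image_mset (fsubst \<rho>) (image_mset (fsubst (\<lambda>i. Var (Suc i))) \<Delta>))"
      by (simp add: image_mset_isubst_Suc image_mset_fsubst_Suc comp_def)
  qed (use Forall.prems in auto)
  then show ?case by (auto intro: f_all)
next
  case (Nu B ts)
  have "wff L [] (fsubst \<tau> (Nu B ts))" using Nu.prems wff_fsubst by blast
  then show ?case using Nu.prems(3)[of Var] by (auto intro!: foc_up_delay)
qed (force intro!: f_store dest: spec[of _ Var])+

lemma decs_reflect:
  assumes "\<forall>P\<in>#\<Delta>. wff L [] P" "wfs L \<tau>"
    and "\<And>\<rho> N. wfs L \<rho> \<Longrightarrow> N \<in> decs L \<Delta> (\<lambda>i. tsubst \<rho> (\<tau> i)) \<Longrightarrow>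
      foc_up L (image_mset (isubst \<rho>) \<Gamma> + N) {#}"
  shows "foc_up L \<Gamma> (image_mset (fsubst \<tau>) \<Delta>)"
  using assms
proof (induction \<Delta> arbitrary: \<tau> \<Gamma>)
  case empty
  then show ?case using empty(3)[of Var] by simp
next
  case (add P \<Delta>)
  have "foc_up L \<Gamma> (add_mset (fsubst \<tau> P) (image_mset (fsubst \<tau>) \<Delta>))"
  proof (rule decf_reflect)
    fix \<rho> N assume \<rho>: "wfs L \<rho>" and N: "N \<in> decf L P (\<lambda>i. tsubst \<rho> (\<tau> i))"
    have "foc_up L (image_mset (isubst \<rho>) \<Gamma> + N) (image_mset (fsubst (\<lambda>i. tsubst \<rho> (\<tau> i))) \<Delta>)"
    proof (rule add.IH)
      fix \<rho>' N' assume \<rho>': "wfs L \<rho>'"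
        and N': "N' \<in> decs L \<Delta> (\<lambda>i. tsubst \<rho>' (tsubst \<rho> (\<tau> i)))"
      have "image_mset (isubst \<rho>') N + N'
          \<in> decs L (add_mset P \<Delta>) (\<lambda>i. tsubst (\<lambda>i. tsubst \<rho>' (\<rho> i)) (\<tau> i))"
        using decf_isubst[OF N \<rho>'] N' by (auto simp: tsubst_tsubst intro: set_plus_intro)
      from add.prems(3)[OF wfs_comp[OF \<rho>' \<rho>] this]
      show "foc_up L (image_mset (isubst \<rho>') (image_mset (isubst \<rho>) \<Gamma> + N) + N') {#}"
        by (simp add: image_mset_isubst_isubst add.assoc)
    qed (use add.prems \<rho> in \<open>auto simp: wfs_comp\<close>)
    then show "foc_up L (image_mset (isubst \<rho>) \<Gamma> + N)
        (image_mset (fsubst \<rho>) (image_mset (fsubst \<tau>) \<Delta>))"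
      by (simp add: image_mset_fsubst_fsubst)
  qed (use add.prems in auto)
  then show ?case by simp
qed

definition good :: "('f, 'a) signature \<Rightarrow> ('f, 'a) form multiset \<Rightarrow> bool" where
  "good L \<Gamma> \<longleftrightarrow> (\<forall>\<sigma> M. wfs L \<sigma> \<longrightarrow> M \<in> decs L \<Gamma> \<sigma> \<longrightarrow> foc_up L M {#})"

lemma goodI: "(\<And>\<sigma> M. wfs L \<sigma> \<Longrightarrow> M \<in> decs L \<Gamma> \<sigma> \<Longrightarrow> foc_up L M {#}) \<Longrightarrow> good L \<Gamma>"
  by (simp add: good_def)

lemma goodD: "good L \<Gamma> \<Longrightarrow> wfs L \<sigma> \<Longrightarrow> M \<in> decs L \<Gamma> \<sigma> \<Longrightarrow> foc_up L M {#}"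
  by (simp add: good_def)

lemma good_foc_up:
  assumes "good L (\<Gamma> + \<Delta>)" "\<forall>P\<in>#\<Delta>. wff L [] P" "wfs L \<sigma>" "M \<in> decs L \<Gamma> \<sigma>"
  shows "foc_up L M (image_mset (fsubst \<sigma>) \<Delta>)"
proof (rule decs_reflect[OF assms(2,3)])
  fix \<rho> N assume "wfs L \<rho>" "N \<in> decs L \<Delta> (\<lambda>i. tsubst \<rho> (\<sigma> i))"
  then show "foc_up L (image_mset (isubst \<rho>) M + N) {#}"
    using assms decs_isubst[OF assms(4), of \<rho>]
    by (intro goodD[OF assms(1) wfs_comp[of L \<rho> \<sigma>]]) (auto intro: set_plus_intro)
qed

lemma good_foc_up_single:
  assumes "good L (add_mset P \<Gamma>)" "wff L [] P" "wfs L \<sigma>" "M \<in> decs L \<Gamma> \<sigma>"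
  shows "foc_up L M {#fsubst \<sigma> P#}"
  using good_foc_up[of L \<Gamma> "{#P#}" \<sigma> M] assms by simp

lemma good_synchronous:
  assumes "good L (add_mset C \<Gamma>)" "\<forall>Q\<in>#add_mset C \<Gamma>. wff L [] Q" "synchronous P"
    and "\<And>\<rho> \<Gamma>. wfs L \<rho> \<Longrightarrow> foc_down L \<Gamma> (fsubst \<rho> C) \<Longrightarrow> foc_down L \<Gamma> (fsubst \<rho> P)"
  shows "good L (add_mset P \<Gamma>)"
proof (rule goodI)
  fix \<sigma> M assume \<sigma>: "wfs L \<sigma>" and "M \<in> decs L (add_mset P \<Gamma>) \<sigma>"
  then obtain N where N: "N \<in> decs L \<Gamma> \<sigma>" "M = N + {#Plain (fsubst \<sigma> P)#}"
    using assms(3) by (auto simp: decf_synchronous elim!: set_plus_elim)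
  have "foc_up L (N + {#Plain (fsubst \<sigma> P)#}) {#}"
  proof (rule foc_up_provides)
    show "foc_up L N {#fsubst \<sigma> C#}"
      using good_foc_up_single[OF assms(1) _ \<sigma> N(1)] assms(2) by simp
    show "wfc L N" using wfc_decs[OF N(1)] assms(2) \<sigma> by simp
    show "wff L [] (fsubst \<sigma> C)" using assms(2) \<sigma> by (simp add: wff_fsubst)
    show "provides L (fsubst \<sigma> C) {#Plain (fsubst \<sigma> P)#} {#}"
      by (rule decide_provides) (use assms(3,4) \<sigma> in \<open>auto simp: fsubst_fsubst wfs_comp\<close>)
  qed
  then show "foc_up L M {#}" by (simp add: N)
qed

lemma good_tensor:
  assumes "good L (add_mset P \<Gamma>)" "good L (add_mset Q \<Delta>)"
    and wf: "\<forall>R\<in>#add_mset P \<Gamma> + add_mset Q \<Delta>. wff L [] R"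
  shows "good L (add_mset (Tensor P Q) (\<Gamma> + \<Delta>))"
proof (rule goodI)
  fix \<sigma> M assume \<sigma>: "wfs L \<sigma>" and "M \<in> decs L (add_mset (Tensor P Q) (\<Gamma> + \<Delta>)) \<sigma>"
  then obtain N N' where N: "N \<in> decs L \<Gamma> \<sigma>" "N' \<in> decs L \<Delta> \<sigma>"
      "M = N + (N' + {#Plain (fsubst \<sigma> (Tensor P Q))#})"
    by (auto elim!: set_plus_elim)
  have wfP: "wff L [] (fsubst \<sigma> P)" "wff L [] (fsubst \<sigma> Q)"
    using wf \<sigma> by (auto simp: wff_fsubst)
  have up: "foc_up L N {#fsubst \<sigma> P#}" "foc_up L N' {#fsubst \<sigma> Q#}"
    using good_foc_up_single[OF assms(1) _ \<sigma> N(1)] good_foc_up_single[OF assms(2) _ \<sigma> N(2)] wf by auto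
  have wfN: "wfc L N" "wfc L N'"
    using wfc_decs[OF N(1)] wfc_decs[OF N(2)] wf \<sigma> by auto
  have "foc_up L (N + (N' + {#Plain (fsubst \<sigma> (Tensor P Q))#})) {#}"
  proof (rule foc_up_provides[OF up(1) wfN(1) wfP(1)], rule providesI)
    fix \<rho> \<Gamma>1 assume \<rho>: "wfs L \<rho>" and 1: "wfc L \<Gamma>1" "foc_down L \<Gamma>1 (fsubst \<rho> (fsubst \<sigma> P))"
    let ?T = "fsubst \<rho> (fsubst \<sigma> (Tensor P Q))"
    have "foc_up L (image_mset (isubst \<rho>) N' + (\<Gamma>1 + {#Plain ?T#})) {#}"
    proof (rule foc_up_provides)
      show "foc_up L (image_mset (isubst \<rho>) N') {#fsubst \<rho> (fsubst \<sigma> Q)#}"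
        using foc_subst(1)[OF up(2) wfN(2) _ \<rho>] wfP by simp
      show "provides L (fsubst \<rho> (fsubst \<sigma> Q)) (\<Gamma>1 + {#Plain ?T#}) {#}"
      proof (rule providesI)
        fix \<rho>' \<Gamma>2
        assume \<rho>': "wfs L \<rho>'" and 2: "foc_down L \<Gamma>2 (fsubst \<rho>' (fsubst \<rho> (fsubst \<sigma> Q)))"
        have "foc_down L (image_mset (isubst \<rho>') \<Gamma>1) (fsubst \<rho>' (fsubst \<rho> (fsubst \<sigma> P)))"
          using foc_subst(2)[OF 1(2,1) _ \<rho>'] wfP \<rho> by (simp add: wff_fsubst)
        from f_tensor[OF this 2]
        have "foc_down L (image_mset (isubst \<rho>') \<Gamma>1 + \<Gamma>2) (fsubst \<rho>' ?T)" by simp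
        from f_decide[OF _ this]
        show "foc_up L (image_mset (isubst \<rho>') (\<Gamma>1 + {#Plain ?T#}) + \<Gamma>2) (image_mset (fsubst \<rho>') {#})"
          by simp
      qed
    qed (use wfN wfP \<rho> in \<open>auto simp: wfc_isubst wff_fsubst\<close>)
    then show "foc_up L (image_mset (isubst \<rho>) (N' + {#Plain (fsubst \<sigma> (Tensor P Q))#}) + \<Gamma>1)
        (image_mset (fsubst \<rho>) {#})"
      by (simp add: ac_simps)
  qed
  then show "foc_up L M {#}" by (simp add: N)
qed

lemma good_forall:
  assumes "good L (add_mset P (image_mset (fsubst (\<lambda>i. Var (Suc i))) \<Gamma>))"
  shows "good L (add_mset (Forall P) \<Gamma>)"
proof (rule goodI)
  fix \<sigma> M assume \<sigma>: "wfs L \<sigma>" and "M \<in> decs L (add_mset (Forall P) \<Gamma>) \<sigma>"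
  then obtain t N N' where N: "wft L t" "N \<in> decf L P (case_nat t \<sigma>)" "N' \<in> decs L \<Gamma> \<sigma>" "M = N + N'"
    by (auto elim!: set_plus_elim)
  then show "foc_up L M {#}"
    using \<sigma> by (intro goodD[OF assms wfs_case_nat[OF N(1) \<sigma>]]) (auto simp: decs_fsubst intro: set_plus_intro)
qed

lemma good_neq:
  assumes "complete_unifiers L u v U" "\<And>\<theta>. \<theta> \<in> U \<Longrightarrow> good L (image_mset (fsubst \<theta>) \<Gamma>)"
  shows "good L (add_mset (Neq u v) \<Gamma>)"
proof (rule goodI)
  fix \<sigma> M assume \<sigma>: "wfs L \<sigma>" and "M \<in> decs L (add_mset (Neq u v) \<Gamma>) \<sigma>"
  then have M: "M \<in> decs L \<Gamma> \<sigma>" "tsubst \<sigma> u = tsubst \<sigma> v"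
    by (auto elim!: set_plus_elim split: if_splits)
  then obtain \<theta> \<tau> where *: "\<theta> \<in> U" "wfs L \<tau>" "\<And>i. \<sigma> i = tsubst \<tau> (\<theta> i)"
    using assms(1) \<sigma> unfolding complete_unifiers_def by blast
  then have "\<sigma> = (\<lambda>i. tsubst \<tau> (\<theta> i))" by auto
  then show "foc_up L M {#}"
    using goodD[OF assms(2)[OF *(1)] *(2)] M(1) by (simp add: decs_fsubst)
qed

lemma good_nu:
  assumes "good L (add_mset (inst ts S) \<Gamma>)" "good L {#app_op (length ts) B S, neg S#}"
    and wf: "\<forall>P\<in>#add_mset (Nu B ts) \<Gamma>. wff L [] P" "wff L [] S"
  shows "good L (add_mset (Nu B ts) \<Gamma>)"
proof (rule goodI)
  fix \<sigma> M assume \<sigma>: "wfs L \<sigma>" and "M \<in> decs L (add_mset (Nu B ts) \<Gamma>) \<sigma>"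
  then obtain N where N: "N \<in> decs L \<Gamma> \<sigma>" "M = add_mset (Plain (delay (fsubst \<sigma> (Nu B ts)))) N"
    by (auto elim!: set_plus_elim)
  let ?n = "length ts"
  let ?\<sigma> = "lift ?n \<sigma>"
  have B: "wff L [?n] B" using wf by simp
  have "foc_up L {#} (image_mset (fsubst ?\<sigma>) {#app_op ?n B S, neg S#})"
    using good_foc_up[of L "{#}" "{#app_op ?n B S, neg S#}" ?\<sigma> "{#}"] assms(2) wf \<sigma>
    by (auto simp: wff_app_op)
  then have coinv: "foc_up L {#} {#app_op ?n (fsubst ?\<sigma> B) (fsubst ?\<sigma> S), neg (fsubst ?\<sigma> S)#}"
    by (simp add: fsubst_app_op[OF B])
  have "foc_up L N {#fsubst \<sigma> (inst ts S)#}"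
    using good_foc_up_single[OF assms(1) _ \<sigma> N(1)] wf by (simp add: wff_inst)
  then have "foc_up L N {#fsubst \<sigma> (Nu B ts)#}"
    using coinv f_nu[of L "fsubst ?\<sigma> S" N "map (tsubst \<sigma>) ts" "{#}" "fsubst ?\<sigma> B"] wf(2) \<sigma>
    by (simp add: fsubst_inst wff_fsubst)
  then have "foc_down L N (delay (fsubst \<sigma> (Nu B ts)))"
    by (intro f_plus1 f_release) auto
  then show "foc_up L M {#}" using N(2) by (auto intro: f_decide)
qed

lemma good_cong_decs: "good L \<Gamma> \<Longrightarrow> (\<And>\<sigma>. decs L \<Delta> \<sigma> = decs L \<Gamma> \<sigma>) \<Longrightarrow> good L \<Delta>"
  by (simp add: good_def)

lemma good_par: "good L (add_mset P (add_mset Q \<Gamma>)) \<Longrightarrow> good L (add_mset (Par P Q) \<Gamma>)"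
  by (erule good_cong_decs) (simp add: add.assoc)

lemma good_bot: "good L \<Gamma> \<Longrightarrow> good L (add_mset Bot \<Gamma>)"
  by (auto simp: good_def elim!: set_plus_elim)

lemma good_top: "good L (add_mset Top \<Gamma>)"
  by (auto simp: good_def elim!: set_plus_elim)

lemma good_with:
  "good L (add_mset P \<Gamma>) \<Longrightarrow> good L (add_mset Q \<Gamma>) \<Longrightarrow> good L (add_mset (With P Q) \<Gamma>)"
  by (force simp: good_def elim!: set_plus_elim intro: set_plus_intro)

lemma good_one: "good L {#One#}"
  by (auto simp: good_def intro!: f_decide f_one elim!: set_plus_elim)

lemma good_eq: "good L {#Eq t t#}"
  by (auto simp: good_def intro!: f_decide f_eq elim!: set_plus_elim)

lemma good_plus1:
  "good L (add_mset P \<Gamma>) \<Longrightarrow> \<forall>R\<in>#add_mset (Plus P Q) \<Gamma>. wff L [] R \<Longrightarrow> good L (add_mset (Plus P Q) \<Gamma>)"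
  by (erule good_synchronous) (auto intro: f_plus1)

lemma good_plus2:
  "good L (add_mset Q \<Gamma>) \<Longrightarrow> \<forall>R\<in>#add_mset (Plus P Q) \<Gamma>. wff L [] R \<Longrightarrow> good L (add_mset (Plus P Q) \<Gamma>)"
  by (erule good_synchronous) (auto intro: f_plus2)

lemma good_ex:
  assumes "good L (add_mset (inst [t] P) \<Gamma>)" "wft L t" "\<forall>R\<in>#add_mset (Exists P) \<Gamma>. wff L [] R"
  shows "good L (add_mset (Exists P) \<Gamma>)"
  using assms(1)
  by (rule good_synchronous)
     (use assms(2,3) in \<open>auto simp: wff_inst fsubst_inst wft_tsubst intro!: f_ex[of L "tsubst \<rho> t" for \<rho>]\<close>)

lemma good_mu:
  assumes "good L (add_mset (unfold_mu B ts) \<Gamma>)" "\<forall>R\<in>#add_mset (Mu B ts) \<Gamma>. wff L [] R"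
  shows "good L (add_mset (Mu B ts) \<Gamma>)"
  using assms(1)
  by (rule good_synchronous)
     (use assms(2) wff_unfold_mu[of L B ts] in \<open>auto simp: fsubst_unfold_mu intro: f_mu\<close>)

lemma good_init_fixed_point: "good L {#Mu B ts, Nu (neg B) ts#}"
proof (rule goodI)
  fix \<sigma> M assume "M \<in> decs L {#Mu B ts, Nu (neg B) ts#} \<sigma>"
  then have M: "M = {#Plain (fsubst \<sigma> (Mu B ts)), Plain (delay (fsubst \<sigma> (Nu (neg B) ts)))#}"
    by (auto elim!: set_plus_elim)
  let ?B = "fsubst (lift (length ts) \<sigma>) B" and ?ts = "map (tsubst \<sigma>) ts"
  have "foc_up L {#Plain (Mu ?B ?ts), Frozen (Nu (neg ?B) ?ts)#} {#}"
    using f_decide[OF _ f_mu_init[of L ?B ?ts]] by simp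
  then show "foc_up L M {#}"
    using foc_thaw(1)[of L _ "{#}" "neg ?B" ?ts "{#Plain (Mu ?B ?ts)#}"]
    by (simp add: M add_mset_commute)
qed

lemma good_init_forall:
  fixes P :: "('f, 'a) form"
  assumes "good L {#P, neg P#}" "wff L [] P"
  shows "good L {#Forall P, Exists (neg P)#}"
proof -
  let ?P = "fsubst (lift 1 (\<lambda>i. Var (Suc i))) (neg P)"
  have "case_nat (Var 0) (\<lambda>i. Var (Suc i)) = (Var :: nat \<Rightarrow> 'f trm)" by (auto split: nat.split)
  then have "inst [Var 0] ?P = neg P" by (simp add: inst_lift)
  then have "good L {#inst [Var 0] ?P, P#}" using assms by (simp add: add_mset_commute)
  then have "good L {#Exists ?P, P#}"
    by (rule good_ex) (use assms in \<open>auto simp: wff_fsubst\<close>)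
  then show ?thesis by (intro good_forall) (simp add: add_mset_commute)
qed

lemma good_init_neq: "good L {#Neq u v, Eq u v#}"
  by (rule good_neq[where U = "{\<theta>. wfs L \<theta> \<and> tsubst \<theta> u = tsubst \<theta> v}"])
     (force simp: complete_unifiers_def good_eq intro: exI[of _ Var])+

lemma good_init_atom: "good L {#NAtom a ts, Atom a ts#}"
proof (rule goodI)
  fix \<sigma> M assume "M \<in> decs L {#NAtom a ts, Atom a ts#} \<sigma>"
  then show "foc_up L M {#}"
    using f_decide[OF _ f_atom_init[of L a "map (tsubst \<sigma>) ts"]]
    by (auto simp: add_mset_commute elim!: set_plus_elim)
qed

lemma good_init_par:
  assumes "good L {#P, neg P#}" "good L {#Q, neg Q#}" "wff L [] P" "wff L [] Q"
  shows "good L {#Par P Q, Tensor (neg P) (neg Q)#}"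
proof -
  have "good L (add_mset (Tensor (neg P) (neg Q)) ({#P#} + {#Q#}))"
    by (rule good_tensor) (use assms in \<open>auto simp: add_mset_commute\<close>)
  then show ?thesis by (intro good_par) (simp add: add_mset_commute)
qed

lemma good_init_with:
  assumes "good L {#P, neg P#}" "good L {#Q, neg Q#}" "wff L [] P" "wff L [] Q"
  shows "good L {#With P Q, Plus (neg P) (neg Q)#}"
proof -
  have "good L (add_mset (Plus (neg P) (neg Q)) {#P#})"
    by (rule good_plus1) (use assms in \<open>auto simp: add_mset_commute\<close>)
  moreover have "good L (add_mset (Plus (neg P) (neg Q)) {#Q#})"
    by (rule good_plus2) (use assms in \<open>auto simp: add_mset_commute\<close>)
  ultimately show ?thesis by (intro good_with) (simp_all add: add_mset_commute)
qed

lemma good_init: "wff L [] P \<Longrightarrow> good L {#P, neg P#}"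
proof (induction P)
  case (Atom a ts)
  then show ?case using good_init_atom[of L a ts] by (simp add: add_mset_commute)
next
  case (NAtom a ts)
  then show ?case using good_init_atom[of L a ts] by simp
next
  case (Eq u v)
  then show ?case using good_init_neq[of L u v] by (simp add: add_mset_commute)
next
  case (Neq u v)
  then show ?case using good_init_neq[of L u v] by simp
next
  case One
  then show ?case using good_bot[OF good_one[of L]] by (simp add: add_mset_commute)
next
  case Bot
  then show ?case using good_bot[OF good_one[of L]] by simp
next
  case Zero
  then show ?case using good_top[of L "{#Zero#}"] by (simp add: add_mset_commute)
next
  case Top
  then show ?case using good_top[of L "{#Zero#}"] by simp
next
  case (Tensor P Q)
  then show ?case using good_init_par[of L "neg P" "neg Q"] by (simp add: add_mset_commute)
next
  case (Par P Q)
  then show ?case using good_init_par[of L P Q] by simp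
next
  case (Plus P Q)
  then show ?case using good_init_with[of L "neg P" "neg Q"] by (simp add: add_mset_commute)
next
  case (With P Q)
  then show ?case using good_init_with[of L P Q] by simp
next
  case (Exists P)
  then show ?case using good_init_forall[of L "neg P"] by (simp add: add_mset_commute)
next
  case (Forall P)
  then show ?case using good_init_forall[of L P] by simp
next
  case (Mu B ts)
  then show ?case using good_init_fixed_point[of L B ts] by simp
next
  case (Nu B ts)
  then show ?case using good_init_fixed_point[of L "neg B" ts] by (simp add: add_mset_commute)
qed simp

lemma derives_good: "derives L d \<Gamma> \<Longrightarrow> cut_free d \<Longrightarrow> \<forall>P\<in>#\<Gamma>. wff L [] P \<Longrightarrow> good L \<Gamma>"
proof (induction rule: derives.induct)
  case (init P)
  then show ?case by (auto intro: good_init)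
next
  case (tensor d P \<Gamma> e Q \<Delta>)
  then show ?case by (intro good_tensor) auto
next
  case (plus1 d P \<Gamma> Q)
  then show ?case by (intro good_plus1) auto
next
  case (plus2 d Q \<Gamma> P)
  then show ?case by (intro good_plus2) auto
next
  case (ex t d P \<Gamma>)
  then show ?case by (intro good_ex[of L t]) (auto simp: wff_inst)
next
  case (all d P \<Gamma>)
  then show ?case by (intro good_forall) (auto simp: wff_fsubst)
next
  case (neq u v U D \<Gamma>)
  then have "wfs L \<theta>" if "\<theta> \<in> U" for \<theta> using that unfolding complete_unifiers_def by blast
  then show ?case using neq by (intro good_neq[of L u v U]) (auto simp: wff_fsubst)
next
  case (mu d B ts \<Gamma>)
  then show ?case using wff_unfold_mu[of L B ts] by (intro good_mu) auto
next
  case (nu n ts S d \<Gamma> e B)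
  then show ?case by (intro good_nu) (auto simp: wff_inst wff_app_op)
qed (auto intro: good_one good_bot good_top good_par good_with good_eq)

lemma cut_free_foc_up:
  assumes "derives L d \<Gamma>" "cut_free d" "\<forall>P\<in>#\<Gamma>. wff L [] P"
  shows "foc_up L {#} \<Gamma>"
  using good_foc_up[of L "{#}" \<Gamma> Var "{#}"] derives_good[OF assms] assms(3) by simp

section \<open>Soundness\<close>

lemma image_mset_item_form_isubst:
  "image_mset item_form (image_mset (isubst \<sigma>) \<Gamma>)
    = image_mset (fsubst \<sigma>) (image_mset item_form \<Gamma>)"
proof (induction \<Gamma>)
  case (add I \<Gamma>)
  then show ?case by (cases I) auto
qed auto

lemma foc_sound:
  "foc_up L \<Gamma> \<Delta> \<Longrightarrow> \<exists>d. derives L d (image_mset item_form \<Gamma> + \<Delta>)"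
  "foc_down L \<Gamma> P \<Longrightarrow> \<exists>d. derives L d (add_mset P (image_mset item_form \<Gamma>))"
proof (induction rule: foc_up_foc_down.inducts)
  case (f_all \<Gamma> P \<Delta>)
  then obtain d where
    "derives L d (add_mset P (image_mset (fsubst (\<lambda>i. Var (Suc i))) (image_mset item_form \<Gamma> + \<Delta>)))"
    by (auto simp: image_mset_item_form_isubst simp del: image_mset_add_mset)
  from derives.all[OF this] show ?case by auto
next
  case (f_neq u v U \<Gamma> \<Delta>)
  then have "\<forall>\<theta>\<in>U. \<exists>d. derives L d (image_mset (fsubst \<theta>) (image_mset item_form \<Gamma> + \<Delta>))"
    by (simp add: image_mset_item_form_isubst)
  then obtain D where "\<And>\<theta>. \<theta> \<in> U \<Longrightarrow> derives L (D \<theta>) (image_mset (fsubst \<theta>) (image_mset item_form \<Gamma> + \<Delta>))"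
    by metis
  from derives.neq[OF f_neq(1) this] show ?case by auto
next
  case (f_tensor \<Gamma> P \<Gamma>' Q)
  then show ?case by (auto dest: derives.tensor)
next
  case (f_nu S \<Gamma> ts \<Delta> B)
  then show ?case by (auto dest: derives.nu[OF refl, of L S])
next
  case (f_mu_init B ts)
  then show ?case using derives.init[of L "Mu B ts"] by auto
next
  case (f_atom_init a ts)
  then show ?case using derives.init[of L "Atom a ts"] by auto
qed (auto intro: derives.intros simp: add_mset_commute)

theorem mainTheorem5:
  fixes L :: "('f, 'a) signature" and \<Gamma> :: "('f, 'a) form multiset"
  assumes "\<forall>P \<in># \<Gamma>. wff L [] P"
  shows "(foc_up L {#} \<Gamma> \<longrightarrow> muMALL_provable L \<Gamma>) \<and>
         ((\<exists>d. derives L d \<Gamma> \<and> quasi_finite d) \<longrightarrow> foc_up L {#} \<Gamma>)"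
proof (intro conjI impI)
  assume "foc_up L {#} \<Gamma>"
  then show "muMALL_provable L \<Gamma>" using foc_sound(1) by (force simp: muMALL_provable_def)
next
  assume "\<exists>d. derives L d \<Gamma> \<and> quasi_finite d"
  then show "foc_up L {#} \<Gamma>" using assms cut_free_foc_up by (auto simp: quasi_finite_def)
qed

end
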